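(* Let $n\ge 4$ be an even integer. The $h^*$-vector of $\operatorname{DP}_n$ equals $$\left(1,2,3,\ldots,\tfrac{n}{2}-1,\tfrac{n}{2},\tfrac{n}{2}-1,\ldots,2,1\right).$$ In particular, the polytope $\operatorname{DP}_n$ is Gorenstein of codegree $n$ and has normalized volume $n^2/4$.
   Context: Dihedral permutation polytope: permutations act from the right, and a permutation $\sigma\in S_n$ is represented by the $n\times n$ permutation matrix $M_\sigma$ with entries $\delta_{i,(j)\sigma}$. The dihedral group $D_n\le S_n$ of order $2n$ is the symmetry group of the regular $n$-gon acting on its $n$ vertices; for $n$ even it is generated by $\rho=(1,2,\ldots,n)$ and $\tau=(2,n)(3,n-1)\cdots(n/2,(n/2)+2)$. Define $\operatorname{DP}_n=\operatorname{conv}(M_\sigma : \sigma\in D_n)\subset\mathbb{R}^{n\times n}$. It is a lattice polytope with respect to $\mathbb{Z}^{n\times n}$. For a lattice polytope $P\subset\mathbb{R}^N$ (vertices in $\mathbb{Z}^N$) of dimension $d$, the Ehrhart polynomial is $L_P(k)=|kP\cap\mathbb{Z}^N|$. Its generating function has the form $$\sum_{m\ge 0}L_P(m)t^m=\frac{h^*(t)}{(1-t)^{d+1}}$$ for a polynomial $h^*(t)=\sum_i h^*_i t^i$ of degree at most $d$ with non-negative integer coefficients; the $h^*$-vector of $P$ is the vector $(h^*_0,h^*_1,\ldots)$ of coefficients of $h^*(t)$, written up to the last non-zero entry. For polytopes that are not full-dimensional, all lattice notions are taken relative to the lattice induced on the affine hull of the polytope, and interiors are relative interiors. A $d$-dimensional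 lattice polytope $P$ in $\mathbb{R}^d$ containing $0$ in its interior is reflexive if its polar polytope $P^*=\{x\in\mathbb{R}^d : \langle x,v\rangle\ge -1 \text{ for all } v\in P\}$ is again a lattice polytope (with respect to the dual lattice). A lattice polytope $P$ is a Gorenstein polytope of codegree $k$ if $k$ is a positive integer and there is an interior lattice point $m$ of $kP$ such that $kP-m$ is a reflexive polytope (with respect to the lattice in the linear span of $kP-m$). The normalized volume of $P$ is the volume on the affine hull of $P$ normalized so that a unimodular simplex of dimension $\dim P$ with respect to the induced lattice has volume $1$. *)

theory Defs
  imports
    "HOL-Analysis.Analysis"
    "HOL-Computational_Algebra.Polynomial_FPS"
    "HOL-Algebra.Sym_Groups"
begin

section \<open>The dihedral permutation polytope\<close>

definition dihedral_rotation :: "nat \<Rightarrow> nat \<Rightarrow> nat" where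
  "dihedral_rotation n i =
     (if i \<in> {1..<n} then i + 1 else if i = n then 1 else i)"

text \<open>For even \<open>n\<close> this is \<open>(2,n)(3,n-1)\<dots>(n/2,n/2+2)\<close>, with fixed points \<open>1\<close> and
  \<open>n/2+1\<close> on the vertex set \<open>{1..n}\<close>.\<close>

definition dihedral_reflection :: "nat \<Rightarrow> nat \<Rightarrow> nat" where
  "dihedral_reflection n i = (if i \<in> {2..n} then n + 2 - i else i)"

text \<open>Reversing the order of composition (permutations acting from the right) does not change
  which permutations lie in the generated subgroup.\<close>

definition dihedral_group :: "nat \<Rightarrow> (nat \<Rightarrow> nat) set" where
  "dihedral_group n = generate (sym_group n) {dihedral_rotation n, dihedral_reflection n}"

text \<open>The matrices are indexed by a type \<open>'n\<close> of cardinality \<open>n\<close>; the bijection \<open>idx\<close> from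
  \<open>'n\<close> to \<open>{1..n}\<close> tells which row or column carries which number.\<close>

definition perm_matrix :: "('n::finite \<Rightarrow> nat) \<Rightarrow> (nat \<Rightarrow> nat) \<Rightarrow> real ^ 'n ^ 'n" where
  "perm_matrix idx \<sigma> = (\<chi> i j. if idx i = \<sigma> (idx j) then 1 else 0)"

definition DP :: "nat \<Rightarrow> ('n::finite \<Rightarrow> nat) \<Rightarrow> (real ^ 'n ^ 'n) set" where
  "DP n idx = convex hull (perm_matrix idx ` dihedral_group n)"

section \<open>Lattice polytopes and Ehrhart theory\<close>

text \<open>On \<open>real ^ 'n ^ 'n\<close> this is the set of matrices with integer entries.\<close>

definition int_lattice :: "'a::euclidean_space set" where
  "int_lattice = {x. \<forall>b\<in>Basis. x \<bullet> b \<in> \<int>}"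

definition lattice_polytope :: "'a::euclidean_space set \<Rightarrow> 'a set \<Rightarrow> bool" where
  "lattice_polytope \<Lambda> P \<longleftrightarrow> polytope P \<and> {v. v extreme_point_of P} \<subseteq> \<Lambda>"

definition dilate :: "nat \<Rightarrow> 'a::euclidean_space set \<Rightarrow> 'a set" where
  "dilate k P = (\<lambda>x. real k *\<^sub>R x) ` P"

definition ehrhart :: "'a::euclidean_space set \<Rightarrow> nat \<Rightarrow> nat" where
  "ehrhart P k = card (dilate k P \<inter> int_lattice)"

definition h_star_poly :: "'a::euclidean_space set \<Rightarrow> real poly" where
  "h_star_poly P = (THE h. Abs_fps (\<lambda>m. real (ehrhart P m)) =
     fps_of_poly h / (1 - fps_X) ^ (nat (aff_dim P) + 1))"

text \<open>\<^const>\<open>coeffs\<close> lists the coefficients from the constant one up to the last non-zero one.\<close>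

definition h_star_vector :: "'a::euclidean_space set \<Rightarrow> real list" where
  "h_star_vector P = coeffs (h_star_poly P)"

section \<open>Reflexive and Gorenstein polytopes\<close>

text \<open>Everything is relative to the linear span \<open>V\<close> of \<open>Q\<close>. The dual space of \<open>V\<close> is identified
  with \<open>V\<close> through the inner product, which turns the dual of a lattice \<open>\<Lambda>\<close> in
  \<open>V\<close> into \<open>dual_lattice V \<Lambda>\<close>.\<close>

definition dual_lattice :: "'a::euclidean_space set \<Rightarrow> 'a set \<Rightarrow> 'a set" where
  "dual_lattice V \<Lambda> = {y \<in> V. \<forall>x\<in>\<Lambda>. y \<bullet> x \<in> \<int>}"

definition polar :: "'a::euclidean_space set \<Rightarrow> 'a set" where
  "polar Q = {y \<in> span Q. \<forall>v\<in>Q. y \<bullet> v \<ge> -1}"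

definition reflexive :: "'a::euclidean_space set \<Rightarrow> bool" where
  "reflexive Q \<longleftrightarrow>
     lattice_polytope (int_lattice \<inter> span Q) Q \<and>
     0 \<in> rel_interior Q \<and>
     lattice_polytope (dual_lattice (span Q) (int_lattice \<inter> span Q)) (polar Q)"

definition gorenstein_of_codegree :: "'a::euclidean_space set \<Rightarrow> nat \<Rightarrow> bool" where
  "gorenstein_of_codegree P k \<longleftrightarrow>
     lattice_polytope int_lattice P \<and> k > 0 \<and>
     (\<exists>m \<in> rel_interior (dilate k P) \<inter> int_lattice.
        reflexive ((\<lambda>x. x - m) ` dilate k P))"

section \<open>Normalized volume\<close>

definition lattice_basis :: "'a::euclidean_space set \<Rightarrow> 'a set \<Rightarrow> bool" where
  "lattice_basis \<Lambda> B \<longleftrightarrow>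
     independent B \<and> \<Lambda> = range (\<lambda>c. \<Sum>b\<in>B. of_int (c b) *\<^sub>R b)"

text \<open>An affine lattice frame of \<open>P\<close>: an origin in the lattice induced on the affine hull of \<open>P\<close>
  together with a basis of that lattice translated to the origin.\<close>

definition lattice_frame :: "'a::euclidean_space set \<Rightarrow> 'a \<Rightarrow> 'a set \<Rightarrow> bool" where
  "lattice_frame P p B \<longleftrightarrow>
     p \<in> affine hull P \<inter> int_lattice \<and>
     lattice_basis ((\<lambda>x. x - p) ` (affine hull P \<inter> int_lattice)) B"

definition frame_coords :: "'a::euclidean_space \<Rightarrow> 'a set \<Rightarrow> 'a set \<Rightarrow> ('a \<Rightarrow> real) set" where
  "frame_coords p B P = {c \<in> B \<rightarrow>\<^sub>E UNIV. p + (\<Sum>b\<in>B. c b *\<^sub>R b) \<in> P}"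

text \<open>Lebesgue measure in the coordinates of a lattice frame does not depend on the frame, and
  gives a unimodular simplex of dimension \<open>d\<close> (such as the convex hull of \<open>p\<close> and all \<open>p + b\<close>,
  \<open>b \<in> B\<close>) the volume \<open>1/d!\<close>; the factor \<open>d!\<close> normalizes this to \<open>1\<close>.\<close>

definition normalized_volume :: "'a::euclidean_space set \<Rightarrow> real" where
  "normalized_volume P =
     (let (p, B) = (SOME (p, B). lattice_frame P p B)
      in fact (nat (aff_dim P)) *
         measure (PiM B (\<lambda>_. lborel)) (frame_coords p B P))"

end

theory Submission
  imports Defs
begin

text \<open>
  The matrix of the rotation \<open>j \<mapsto> j + k\<close> has its ones where \<open>i - j = k\<close> modulo \<open>n\<close>, the matrix of the
  reflection \<open>j \<mapsto> l - j\<close> where \<open>i + j = l\<close>. A combination of these matrices with weights \<open>a\<^sub>k\<close> and \<open>b\<^sub>l\<close>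
  therefore has the entry \<open>a\<^sub>i\<^sub>-\<^sub>j + b\<^sub>i\<^sub>+\<^sub>j\<close> at \<open>(i, j)\<close>. For even \<open>n\<close> the indices \<open>i - j\<close> and
  \<open>i + j\<close> have the same parity, and every pair of indices of equal parity occurs. Hence there are exactly
  two linear relations: the rotations with even \<open>k\<close> and the reflections with even \<open>l\<close> have the same sum,
  and likewise for odd indices. The polytope thus has dimension \<open>2n - 3\<close>.

  Along these relations the weights can be normalized so that the minimum of the \<open>a\<^sub>k\<close> is zero within each
  parity class. Normalized weights are unique, and they are nonnegative or integral whenever all the
  matrix entries are (lemmas \<open>reduced_unique\<close>, \<open>reduced_nonneg\<close>, \<open>reduced_integral\<close>). So the polytope
  \<open>P\<close> is cut out of its affine hull by the inequalities \<open>x\<^sub>i\<^sub>j \<ge> 0\<close>, and the lattice points of \<open>k P\<close>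
  correspond to the families of \<open>2n\<close> natural numbers with sum \<open>k\<close> in which some even and some odd rotation
  has weight zero. By inclusion and exclusion the Ehrhart series is
  \<open>(1 - t^(n/2))^2 / (1 - t)^(2n) = (1 + t + \<dots> + t^(n/2 - 1))^2 / (1 - t)^(2n - 2)\<close>,
  and the numerator on the right-hand side has the coefficients \<open>1, 2, \<dots>, n/2, \<dots>, 2, 1\<close>.

  The volume is measured in an arbitrary lattice frame. In every frame it is the limit of the number of
  lattice points of \<open>k P\<close> divided by \<open>k^(2n - 3)\<close> (lemma \<open>ehrhart_over_power_tendsto_volume\<close>), and the
  Ehrhart series shows that this limit is the value of the numerator at \<open>1\<close>, namely \<open>(n/2)^2\<close>, divided
  by \<open>(2n - 3)!\<close>. Since the definition chooses a frame, one also has to be exhibited; it is given by the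
  differences of the vertices that remain when one reflection of each parity is left out.

  For the Gorenstein property, the all-ones matrix is the sum of all rotations and so lies in \<open>n P\<close>.
  Translating it to the origin turns the inequalities into \<open>y\<^sub>i\<^sub>j \<ge> -1\<close>. The polar is then the
  convex hull of the functionals \<open>y \<mapsto> y\<^sub>i\<^sub>j\<close>, which are integral on lattice points
  (lemma \<open>polar_eq_convex_hull_of_facet_normals\<close>).
\<close>

section \<open>Weak compositions and their generating functions\<close>

definition weak_comps :: "nat \<Rightarrow> nat \<Rightarrow> (nat \<Rightarrow> nat) set" where
  "weak_comps N k = {f. (\<forall>t\<ge>N. f t = 0) \<and> (\<Sum>t<N. f t) = k}"

text \<open>
  The inverse of \<open>1 - X\<close>. Writing \<open>1 / (1 - X)^N\<close> as a power of this series turns all divisions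
  into products.
\<close>

abbreviation geometric_fps :: "real fps" where
  "geometric_fps \<equiv> Abs_fps (\<lambda>_. 1)"

lemma one_minus_X_geometric: "(1 - fps_X) * geometric_fps = 1"
proof (rule fps_ext)
  fix k show "fps_nth ((1 - fps_X) * geometric_fps) k = fps_nth 1 k"
    by (cases k) (simp_all add: left_diff_distrib fps_X_mult_nth)
qed

lemma divide_one_minus_X_power:
  "(g :: real fps) / (1 - fps_X) ^ N = g * geometric_fps ^ N"
proof -
  have "inverse ((1 - fps_X) ^ N) = geometric_fps ^ N"
    by (rule fps_inverse_unique)
      (simp add: one_minus_X_geometric flip: power_mult_distrib)
  then show ?thesis by (subst fps_divide_unit) simp_all
qed

lemma geometric_fps_power_nth:
  assumes "N > 0"
  shows "fps_nth (geometric_fps ^ N) k = real ((k + N - 1) choose k)"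
proof -
  have "fps_nth (geometric_fps ^ N) k = real (card (natpermute k N))"
    using assms by (subst fps_power_nth) simp
  then show ?thesis
    by (simp add: natpermute_def card_length_sum_list)
qed

lemma bij_betw_weak_comps_natpermute:
  "bij_betw (\<lambda>f. map f [0..<N]) (weak_comps N k) (natpermute k N)"
proof (rule bij_betwI[where g = "\<lambda>l t. if t < N then l ! t else 0"])
  show "(\<lambda>f. map f [0..<N]) \<in> weak_comps N k \<rightarrow> natpermute k N"
    by (auto simp: weak_comps_def natpermute_def interv_sum_list_conv_sum_set_nat lessThan_atLeast0)
  show "(\<lambda>l t. if t < N then l ! t else 0) \<in> natpermute k N \<rightarrow> weak_comps N k"
    by (auto simp: weak_comps_def natpermute_def sum_list_sum_nth lessThan_atLeast0)
  show "(\<lambda>t. if t < N then map f [0..<N] ! t else 0) = f" if "f \<in> weak_comps N k" for f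
    using that by (auto simp: weak_comps_def fun_eq_iff)
  show "map (\<lambda>t. if t < N then l ! t else 0) [0..<N] = l" if "l \<in> natpermute k N" for l
    using that by (auto simp: natpermute_def intro!: nth_equalityI)
qed

lemma finite_weak_comps: "finite (weak_comps N k)"
  using bij_betw_finite[OF bij_betw_weak_comps_natpermute] natpermute_finite by blast

lemma card_weak_comps: "N > 0 \<Longrightarrow> real (card (weak_comps N k)) = fps_nth (geometric_fps ^ N) k"
  using bij_betw_same_card[OF bij_betw_weak_comps_natpermute, of N k]
  by (simp add: geometric_fps_power_nth natpermute_def card_length_sum_list)

text \<open>
  Lowering the entries in \<open>A\<close> by one gives the weak compositions of \<open>k - card A\<close>, and this shift of
  the total is the factor \<open>X^(card A)\<close>.
\<close>

lemma card_weak_comps_positive_on: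
  assumes "N > 0" and A: "A \<subseteq> {..<N}"
  shows "real (card {f \<in> weak_comps N k. \<forall>t\<in>A. f t > 0}) = fps_nth (fps_X ^ card A * geometric_fps ^ N) k"
proof -
  let ?e = "\<lambda>t. if t \<in> A then 1 else (0::nat)"
  have fin: "finite A" using A finite_subset by blast
  have sum_e: "(\<Sum>t<N. ?e t) = card A"
    using A by (simp add: sum.If_cases fin Int_absorb1)
  show ?thesis
  proof (cases "card A \<le> k")
    case True
    have "bij_betw (\<lambda>f t. f t - ?e t) {f \<in> weak_comps N k. \<forall>t\<in>A. f t > 0} (weak_comps N (k - card A))"
    proof (rule bij_betwI[where g = "\<lambda>f t. f t + ?e t"])
      have "(\<lambda>t. f t - ?e t) \<in> weak_comps N (k - card A)"
        if f: "f \<in> weak_comps N k" "\<forall>t\<in>A. f t > 0" for f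
      proof -
        have "(\<Sum>t<N. f t - ?e t) = (\<Sum>t<N. f t) - (\<Sum>t<N. ?e t)"
          by (rule sum_subtractf_nat) (use f in \<open>auto simp: Suc_le_eq\<close>)
        then show ?thesis using f sum_e by (auto simp: weak_comps_def)
      qed
      then show "(\<lambda>f t. f t - ?e t) \<in> {f \<in> weak_comps N k. \<forall>t\<in>A. f t > 0} \<rightarrow> weak_comps N (k - card A)"
        by auto
      show "(\<lambda>f t. f t + ?e t) \<in> weak_comps N (k - card A) \<rightarrow> {f \<in> weak_comps N k. \<forall>t\<in>A. f t > 0}"
        using A True sum_e by (auto simp: weak_comps_def sum.distrib)
    qed (auto simp: fun_eq_iff)
    then have "card {f \<in> weak_comps N k. \<forall>t\<in>A. f t > 0} = card (weak_comps N (k - card A))"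
      by (rule bij_betw_same_card)
    then show ?thesis
      using True assms by (simp add: card_weak_comps fps_X_power_mult_nth)
  next
    case False
    have bound: "card A \<le> k" if "f \<in> weak_comps N k" "\<forall>t\<in>A. f t > 0" for f
    proof -
      have "card A = (\<Sum>t<N. ?e t)" using sum_e by simp
      also have "\<dots> \<le> (\<Sum>t<N. f t)" using that by (intro sum_mono) (auto simp: Suc_le_eq)
      finally show ?thesis using that by (simp add: weak_comps_def)
    qed
    have empty: "{f \<in> weak_comps N k. \<forall>t\<in>A. f t > 0} = {}"
    proof (rule equals0I)
      fix f assume "f \<in> {f \<in> weak_comps N k. \<forall>t\<in>A. f t > 0}"
      with bound False show False by blast
    qed
    show ?thesis unfolding empty using False by (simp add: fps_X_power_mult_nth)
  qed
qed

text \<open>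
  Inclusion and exclusion over the two events that a composition is positive on all of \<open>A\<close> and
  that it is positive on all of \<open>B\<close>.
\<close>

lemma card_weak_comps_zero_in_each:
  assumes "N > 0" and A: "A \<subseteq> {..<N}" and B: "B \<subseteq> {..<N}" and "A \<inter> B = {}"
  shows "real (card {f \<in> weak_comps N k. (\<exists>t\<in>A. f t = 0) \<and> (\<exists>t\<in>B. f t = 0)}) =
    fps_nth ((1 - fps_X ^ card A) * (1 - fps_X ^ card B) * geometric_fps ^ N) k"
proof -
  let ?pos = "\<lambda>C. {f \<in> weak_comps N k. \<forall>t\<in>C. f t > 0}"
  have fin: "finite (?pos C)" for C using finite_weak_comps by simp
  have "{f \<in> weak_comps N k. (\<exists>t\<in>A. f t = 0) \<and> (\<exists>t\<in>B. f t = 0)} = weak_comps N k - (?pos A \<union> ?pos B)"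
    by auto
  moreover have "card (weak_comps N k - (?pos A \<union> ?pos B)) = card (weak_comps N k) - card (?pos A \<union> ?pos B)"
    by (rule card_Diff_subset) (auto simp: finite_weak_comps)
  moreover have "card (?pos A \<union> ?pos B) \<le> card (weak_comps N k)"
    by (rule card_mono) (auto simp: finite_weak_comps)
  moreover have "card (?pos A) + card (?pos B) = card (?pos A \<union> ?pos B) + card (?pos A \<inter> ?pos B)"
    by (rule card_Un_Int) (rule fin)+
  moreover have "?pos A \<inter> ?pos B = ?pos (A \<union> B)" by auto
  ultimately have "real (card {f \<in> weak_comps N k. (\<exists>t\<in>A. f t = 0) \<and> (\<exists>t\<in>B. f t = 0)}) =
     real (card (weak_comps N k)) - real (card (?pos A)) - real (card (?pos B)) + real (card (?pos (A \<union> B)))"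
    by (simp add: of_nat_diff)
  moreover have "card (A \<union> B) = card A + card B"
    using assms finite_subset by (intro card_Un_disjoint) blast+
  ultimately show ?thesis
    using assms card_weak_comps_positive_on[of N A k] card_weak_comps_positive_on[of N B k]
      card_weak_comps_positive_on[of N "A \<union> B" k]
    by (simp add: card_weak_comps algebra_simps power_add)
qed

text \<open>
  As a function of \<open>k\<close> the binomial coefficient is a polynomial of degree \<open>d\<close> with leading
  coefficient \<open>1 / d!\<close>, whatever the fixed shift \<open>i\<close>.
\<close>

lemma choose_over_power_tendsto:
  "(\<lambda>k. real ((k + d - i) choose d) / real k ^ d) \<longlonglongrightarrow> 1 / fact d"
proof -
  have lim: "(\<lambda>k. \<Prod>j=0..<d. (real k + real d - real i - real j) / real k) \<longlonglongrightarrow> (\<Prod>j=0..<d. 1)"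
  proof (rule tendsto_prod)
    fix j
    have "(\<lambda>k. 1 + (real d - real i - real j) * (1 / real k)) \<longlonglongrightarrow> 1 + (real d - real i - real j) * 0"
      by (intro tendsto_intros lim_1_over_n)
    moreover have "\<forall>\<^sub>F k in sequentially. 1 + (real d - real i - real j) * (1 / real k) =
      (real k + real d - real i - real j) / real k"
      using eventually_gt_at_top[of 0] by eventually_elim (simp add: field_simps)
    ultimately show "(\<lambda>k. (real k + real d - real i - real j) / real k) \<longlonglongrightarrow> 1"
      using Lim_transform_eventually by fastforce
  qed
  have quot: "real ((k + d - i) choose d) / real k ^ d = (\<Prod>j=0..<d. (real k + real d - real i - real j) / real k) / fact d" if "k \<ge> i" for k
    using that by (simp add: binomial_gbinomial gbinomial_prod_rev prod_dividef of_nat_diff algebra_simps)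
  have "\<forall>\<^sub>F k in sequentially. (\<Prod>j=0..<d. (real k + real d - real i - real j) / real k) / fact d =
     real ((k + d - i) choose d) / real k ^ d"
    using eventually_ge_at_top[of i] by eventually_elim (simp only: quot)
  moreover have "(\<lambda>k. (\<Prod>j=0..<d. (real k + real d - real i - real j) / real k) / fact d) \<longlonglongrightarrow> 1 / fact d"
    using tendsto_divide[OF lim tendsto_const, of "fact d"] by simp
  ultimately show ?thesis by (rule Lim_transform_eventually[rotated])
qed

text \<open>
  The coefficients of \<open>h / (1 - X)^(d + 1)\<close> are eventually \<open>\<Sum>i. h\<^sub>i * binom (k - i + d, d)\<close>, and each
  binomial coefficient contributes \<open>1 / d!\<close> to the leading term. Applied to an Ehrhart series this
  is the volume of the polytope.
\<close>

lemma series_coefficients_over_power_tendsto: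
  assumes gf: "Abs_fps L = fps_of_poly h / (1 - fps_X) ^ (d + 1)"
  shows "(\<lambda>k. L k / real k ^ d) \<longlonglongrightarrow> poly h 1 / fact d"
proof -
  have L: "L k = (\<Sum>i\<le>degree h. coeff h i * real ((k + d - i) choose d))" if "k \<ge> degree h" for k
  proof -
    have "L k = fps_nth (fps_of_poly h * geometric_fps ^ (d + 1)) k"
      using gf unfolding divide_one_minus_X_power by (metis fps_nth_Abs_fps)
    also have "\<dots> = (\<Sum>i=0..k. coeff h i * real ((k - i + d) choose (k - i)))"
      by (simp add: fps_mult_nth geometric_fps_power_nth del: power_Suc)
    also have "\<dots> = (\<Sum>i\<le>degree h. coeff h i * real ((k - i + d) choose (k - i)))"
      using that by (intro sum.mono_neutral_right) (auto simp: coeff_eq_0)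
    also have "\<dots> = (\<Sum>i\<le>degree h. coeff h i * real ((k + d - i) choose d))"
    proof (rule sum.cong[OF refl])
      fix i assume "i \<in> {..degree h}"
      with that have "i \<le> k" by simp
      then have "((k - i + d) choose (k - i)) = ((k + d - i) choose d)"
        using binomial_symmetric[of d "k - i + d"] by simp
      then show "coeff h i * real ((k - i + d) choose (k - i)) = coeff h i * real ((k + d - i) choose d)" by simp
    qed
    finally show ?thesis .
  qed
  have "(\<lambda>k. \<Sum>i\<le>degree h. coeff h i * (real ((k + d - i) choose d) / real k ^ d)) \<longlonglongrightarrow>
     (\<Sum>i\<le>degree h. coeff h i * (1 / fact d))"
    by (intro tendsto_intros choose_over_power_tendsto)
  moreover have "(\<Sum>i\<le>degree h. coeff h i * (1 / fact d)) = poly h 1 / fact d"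
    by (simp add: poly_altdef sum_divide_distrib)
  moreover have "\<forall>\<^sub>F k in sequentially. (\<Sum>i\<le>degree h. coeff h i * (real ((k + d - i) choose d) / real k ^ d)) = L k / real k ^ d"
    using eventually_ge_at_top[of "degree h"]
    by eventually_elim (simp only: L sum_divide_distrib times_divide_eq_right)
  ultimately show ?thesis using Lim_transform_eventually by fastforce
qed

section \<open>Volume as a limit of lattice point counts\<close>

text \<open>
  Fubini: a line in the direction of a coordinate \<open>b\<close> with \<open>a b \<noteq> 0\<close> meets the hyperplane in a single
  point.
\<close>

lemma AE_PiM_lborel_off_hyperplane:
  fixes a :: "'b \<Rightarrow> real"
  assumes "finite B" "b \<in> B" "a b \<noteq> 0"
  shows "AE x in PiM B (\<lambda>_. lborel). \<beta> + (\<Sum>b\<in>B. a b * x b) \<noteq> 0"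
proof -
  interpret product_sigma_finite "\<lambda>_::'b. lborel :: real measure" by standard
  define B' where "B' = B - {b}"
  have B: "B = insert b B'" "finite B'" "b \<notin> B'" using assms by (auto simp: B'_def)
  let ?M = "PiM (insert b B') (\<lambda>_. lborel :: real measure)"
  let ?H = "{x \<in> space ?M. \<beta> + (\<Sum>b\<in>insert b B'. a b * x b) = 0}"
  have H: "?H \<in> sets ?M" by measurable
  have "emeasure ?M ?H = (\<integral>\<^sup>+x. indicator ?H x \<partial>?M)" using H by simp
  also have "\<dots> = (\<integral>\<^sup>+x. (\<integral>\<^sup>+y. indicator ?H (x(b := y)) \<partial>lborel) \<partial>PiM B' (\<lambda>_. lborel))"
    using B H by (intro product_nn_integral_insert) auto
  also have "\<dots> = (\<integral>\<^sup>+x. 0 \<partial>PiM B' (\<lambda>_. lborel :: real measure))"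
  proof (rule nn_integral_cong)
    fix x :: "'b \<Rightarrow> real"
    let ?y = "- (\<beta> + (\<Sum>i\<in>B'. a i * x i)) / a b"
    have "indicator ?H (x(b := y)) \<le> (indicator {?y} y :: ennreal)" for y
    proof (cases "x(b := y) \<in> ?H")
      case True
      have "(\<Sum>i\<in>B'. a i * (x(b := y)) i) = (\<Sum>i\<in>B'. a i * x i)"
        using B by (intro sum.cong) auto
      with True have "\<beta> + (a b * y + (\<Sum>i\<in>B'. a i * x i)) = 0" using B by simp
      then have "y = ?y" using assms by (simp add: field_simps)
      then show ?thesis by (simp add: indicator_def)
    qed simp
    then have "(\<integral>\<^sup>+y. indicator ?H (x(b := y)) \<partial>lborel) \<le> (\<integral>\<^sup>+y. indicator {?y} y \<partial>lborel)"
      by (intro nn_integral_mono) auto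
    then show "(\<integral>\<^sup>+y. indicator ?H (x(b := y)) \<partial>lborel) = 0" by simp
  qed
  finally have "emeasure ?M ?H = 0" by simp
  then have "?H \<in> null_sets ?M" using H by (simp add: null_setsI)
  then show ?thesis
    unfolding B(1) by (rule AE_I') auto
qed

text \<open>
  Round every point down to the grid \<open>(1/k)\<int>^B\<close>, and let \<open>U k\<close> be the set of points that are rounded into
  \<open>S\<close>. It is a disjoint union of cubes of side \<open>1/k\<close>, one for each grid point of \<open>S\<close>. For \<open>k\<close>
  tending to infinity the indicator functions of \<open>U k\<close> converge to that of \<open>S\<close> at every point off the
  bounding hyperplanes, so their integrals converge by dominated convergence. The hypothesis
  \<open>nonconst\<close> ensures that each bounding hyperplane is a null set.
\<close>

lemma lattice_count_tendsto_measure: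
  fixes \<alpha> :: "'j \<Rightarrow> 'b \<Rightarrow> real" and \<beta> :: "'j \<Rightarrow> real" and R :: real
  assumes fin: "finite B" "finite J"
    and nonconst: "\<And>j. j \<in> J \<Longrightarrow> \<exists>b\<in>B. \<alpha> j b \<noteq> 0"
    and S: "S = {c \<in> B \<rightarrow>\<^sub>E UNIV. \<forall>j\<in>J. 0 \<le> \<beta> j + (\<Sum>b\<in>B. \<alpha> j b * c b)}"
    and bounded: "S \<subseteq> B \<rightarrow>\<^sub>E {-R..R}"
  shows "(\<lambda>k. real (card {z \<in> B \<rightarrow>\<^sub>E (UNIV :: int set). (\<lambda>b\<in>B. of_int (z b) / real k) \<in> S}) / real k ^ card B)
    \<longlonglongrightarrow> measure (PiM B (\<lambda>_. lborel)) S"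
proof -
  interpret product_sigma_finite "\<lambda>_::'b. lborel :: real measure" by standard
  let ?M = "PiM B (\<lambda>_. lborel :: real measure)"
  define q where "q k x = (\<lambda>b\<in>B. of_int \<lfloor>real k * x b\<rfloor> / real k)" for k and x :: "'b \<Rightarrow> real"
  define U where "U k = q k -` S \<inter> space ?M" for k
  define Z where "Z k = {z \<in> B \<rightarrow>\<^sub>E (UNIV :: int set). (\<lambda>b\<in>B. of_int (z b) / real k) \<in> S}" for k :: nat
  have space: "space ?M = B \<rightarrow>\<^sub>E UNIV" by (simp add: space_PiM)
  have "S = {c \<in> space ?M. \<forall>j\<in>J. 0 \<le> \<beta> j + (\<Sum>b\<in>B. \<alpha> j b * c b)}"
    using S space by simp
  also have "\<dots> \<in> sets ?M" using fin(2) by measurable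
  finally have S_sets [measurable]: "S \<in> sets ?M" .
  have [measurable]: "q k \<in> measurable ?M ?M" for k
    unfolding q_def by measurable
  have U_sets [measurable]: "U k \<in> sets ?M" for k
    unfolding U_def by measurable
  \<comment> \<open>One cube of volume \<open>(1/k)^(card B)\<close> for every grid point in \<open>S\<close>.\<close>
  have measure_U: "measure ?M (U k) = real (card (Z k)) / real k ^ card B" if k: "k > 0" for k
  proof -
    let ?C = "\<lambda>z::'b \<Rightarrow> int. PiE B (\<lambda>b. {of_int (z b) / real k ..< (of_int (z b) + 1) / real k})"
    have floor: "\<lfloor>real k * x b\<rfloor> = z b" if "x \<in> ?C z" "b \<in> B" for x z b
    proof -
      have "of_int (z b) / real k \<le> x b" "x b < (of_int (z b) + 1) / real k"
        using that by auto
      then show ?thesis using k by (intro floor_unique) (auto simp: field_simps)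
    qed
    have finZ: "finite (Z k)"
    proof (rule finite_subset)
      show "Z k \<subseteq> B \<rightarrow>\<^sub>E {- \<lceil>real k * R\<rceil>..\<lceil>real k * R\<rceil>}"
      proof (intro subsetI PiE_I)
        fix z b assume z: "z \<in> Z k" and b: "b \<in> B"
        then have "(\<lambda>b\<in>B. of_int (z b) / real k) \<in> B \<rightarrow>\<^sub>E {-R..R}"
          using bounded unfolding Z_def by blast
        with b have "of_int (z b) / real k \<in> {-R..R}" by (auto simp: PiE_iff)
        then have "- (real k * R) \<le> of_int (z b)" "of_int (z b) \<le> real k * R"
          using k by (auto simp: field_simps)
        then show "z b \<in> {- \<lceil>real k * R\<rceil>..\<lceil>real k * R\<rceil>}" by simp linarith
      qed (auto simp: Z_def)
    qed (use fin in \<open>auto intro: finite_PiE\<close>)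
    have "U k = (\<Union>z\<in>Z k. ?C z)"
    proof (intro equalityI subsetI)
      fix x assume x: "x \<in> U k"
      let ?z = "\<lambda>b\<in>B. \<lfloor>real k * x b\<rfloor>"
      have "(\<lambda>b\<in>B. of_int (?z b) / real k) = q k x" by (auto simp: q_def)
      then have "?z \<in> Z k" using x by (auto simp: Z_def U_def)
      moreover have lt: "real k * y < 1 + of_int \<lfloor>real k * y\<rfloor>" for y
        by linarith
      have "x \<in> ?C ?z"
        using x k by (auto simp: U_def space PiE_iff field_simps intro: lt)
      ultimately show "x \<in> (\<Union>z\<in>Z k. ?C z)" by blast
    next
      fix x assume "x \<in> (\<Union>z\<in>Z k. ?C z)"
      then obtain z where z: "z \<in> Z k" "x \<in> ?C z" by blast
      then have "q k x = (\<lambda>b\<in>B. of_int (z b) / real k)"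
        using floor by (auto simp: q_def)
      then show "x \<in> U k" using z by (auto simp: U_def Z_def space)
    qed
    moreover have "disjoint_family_on ?C (Z k)"
    proof (unfold disjoint_family_on_def, intro ballI impI)
      fix z w assume zw: "z \<in> Z k" "w \<in> Z k" "z \<noteq> w"
      have "z \<in> B \<rightarrow>\<^sub>E UNIV" "w \<in> B \<rightarrow>\<^sub>E UNIV" using zw by (simp_all add: Z_def)
      from PiE_ext[OF this] zw(3) obtain b where b: "b \<in> B" "z b \<noteq> w b" by metis
      have "z b = w b" if "x \<in> ?C z" "x \<in> ?C w" for x
        using floor[OF that(1) b(1)] floor[OF that(2) b(1)] by simp
      then show "?C z \<inter> ?C w = {}" using b(2) by blast
    qed
    moreover have C: "emeasure ?M (?C z) = ennreal (1 / real k ^ card B)" for z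
    proof -
      have "emeasure ?M (?C z) = (\<Prod>b\<in>B. ennreal (1 / real k))"
        using fin k by (subst emeasure_PiM) (auto intro!: prod.cong simp: divide_right_mono simp flip: diff_divide_distrib)
      also have "\<dots> = ennreal (1 / real k ^ card B)"
        by (simp add: ennreal_power power_one_over)
      finally show ?thesis .
    qed
    ultimately have "measure ?M (U k) = (\<Sum>z\<in>Z k. measure ?M (?C z))"
      using finZ fin by (simp only:) (rule measure_finite_Union; auto intro!: sets_PiM_I_finite)
    also have "\<dots> = (\<Sum>z\<in>Z k. 1 / real k ^ card B)"
      using C by (intro sum.cong) (auto simp: measure_def)
    finally show ?thesis by simp
  qed
  have approx: "q k x b \<le> x b \<and> x b \<le> q k x b + 1 / real k" if "k > 0" "b \<in> B" for k x b
  proof -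
    have "of_int \<lfloor>real k * x b\<rfloor> \<le> real k * x b" "real k * x b \<le> of_int \<lfloor>real k * x b\<rfloor> + 1"
      by linarith+
    then show ?thesis using that by (simp add: q_def field_simps)
  qed
  have q_lim: "(\<lambda>k. q k x b) \<longlonglongrightarrow> x b" if "b \<in> B" for x b
  proof (rule tendsto_sandwich[where f = "\<lambda>k. x b - 1 / real k" and h = "\<lambda>k. x b"])
    show "\<forall>\<^sub>F k in sequentially. x b - 1 / real k \<le> q k x b"
      using eventually_gt_at_top[of 0] by eventually_elim (use approx that in \<open>force simp: algebra_simps\<close>)
    show "\<forall>\<^sub>F k in sequentially. q k x b \<le> x b"
      using eventually_gt_at_top[of 0] by eventually_elim (use approx that in blast)
    show "(\<lambda>k. x b - 1 / real k) \<longlonglongrightarrow> x b"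
      using tendsto_diff[OF tendsto_const lim_1_over_n, of "x b"] by simp
  qed simp
  have "AE x in ?M. \<forall>j\<in>J. \<beta> j + (\<Sum>b\<in>B. \<alpha> j b * x b) \<noteq> 0"
    using nonconst fin by (intro AE_finite_allI) (auto intro: AE_PiM_lborel_off_hyperplane)
  \<comment> \<open>Off the hyperplanes all constraints are strict or one is strictly violated, and both are
    open conditions.\<close>
  then have pointwise: "AE x in ?M. (\<lambda>k. indicator (U k) x :: real) \<longlonglongrightarrow> indicator S x"
  proof eventually_elim
    fix x assume x: "\<forall>j\<in>J. \<beta> j + (\<Sum>b\<in>B. \<alpha> j b * x b) \<noteq> 0"
    show "(\<lambda>k. indicator (U k) x :: real) \<longlonglongrightarrow> indicator S x"
    proof (cases "x \<in> space ?M")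
      case True
      have lim: "(\<lambda>k. \<beta> j + (\<Sum>b\<in>B. \<alpha> j b * q k x b)) \<longlonglongrightarrow> \<beta> j + (\<Sum>b\<in>B. \<alpha> j b * x b)" for j
        by (intro tendsto_intros q_lim)
      have "\<forall>\<^sub>F k in sequentially. indicator (U k) x = (indicator S x :: real)"
      proof (cases "x \<in> S")
        case True
        then have "\<forall>j\<in>J. 0 < \<beta> j + (\<Sum>b\<in>B. \<alpha> j b * x b)" using x unfolding S by force
        then have "\<forall>\<^sub>F k in sequentially. \<forall>j\<in>J. 0 < \<beta> j + (\<Sum>b\<in>B. \<alpha> j b * q k x b)"
          using fin lim by (auto intro!: eventually_ball_finite dest: order_tendstoD(1))
        then show ?thesis
          by eventually_elim (use True \<open>x \<in> space ?M\<close> in \<open>auto simp: U_def S q_def indicator_def less_imp_le\<close>)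
      next
        case False
        then obtain j where j: "j \<in> J" "\<beta> j + (\<Sum>b\<in>B. \<alpha> j b * x b) < 0"
          using True x unfolding S space by force
        from order_tendstoD(2)[OF lim j(2)] show ?thesis
          by eventually_elim (use False j(1) in \<open>auto simp: U_def S indicator_def not_le\<close>)
      qed
      then show ?thesis by (rule tendsto_eventually)
    next
      case False
      then show ?thesis by (simp add: U_def S space)
    qed
  qed
  \<comment> \<open>Rounding moves a coordinate by at most \<open>1/k \<le> 1\<close>, so this box contains all the sets \<open>U k\<close> with
    \<open>k \<ge> 1\<close>; the index is shifted to \<open>Suc k\<close> because \<open>k = 0\<close> means division by zero.\<close>
  let ?D = "PiE B (\<lambda>_. {-R..R + 1})"
  have D: "?D \<in> sets ?M" using fin by (intro sets_PiM_I_finite) auto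
  have D_fin: "emeasure ?M ?D < \<infinity>"
    using fin by (subst emeasure_PiM) (auto simp: power_less_top_ennreal emeasure_lborel_Icc_eq)
  have "(\<lambda>k. \<integral>x. indicator (U (Suc k)) x \<partial>?M) \<longlonglongrightarrow> (\<integral>x. indicator S x \<partial>?M :: real)"
  proof (rule integral_dominated_convergence[where w = "indicator ?D"])
    show "integrable ?M (indicator ?D :: _ \<Rightarrow> real)" using D D_fin by simp
    show "AE x in ?M. (\<lambda>k. indicator (U (Suc k)) x :: real) \<longlonglongrightarrow> indicator S x"
      using pointwise by eventually_elim (rule LIMSEQ_Suc)
    have "U (Suc k) \<subseteq> ?D" for k
    proof
      fix x assume x: "x \<in> U (Suc k)"
      then have q: "q (Suc k) x \<in> B \<rightarrow>\<^sub>E {-R..R}" using bounded by (auto simp: U_def)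
      have "x b \<in> {-R..R + 1}" if b: "b \<in> B" for b
      proof -
        have "q (Suc k) x b \<in> {-R..R}" using q b by auto
        moreover have "1 / real (Suc k) \<le> 1" by simp
        moreover have "q (Suc k) x b \<le> x b \<and> x b \<le> q (Suc k) x b + 1 / real (Suc k)"
          using b by (intro approx) simp_all
        ultimately show ?thesis unfolding atLeastAtMost_iff by linarith
      qed
      then show "x \<in> ?D" using x by (auto simp: U_def space)
    qed
    then show "AE x in ?M. norm (indicator (U (Suc k)) x :: real) \<le> indicator ?D x" for k
      by (intro AE_I2) (auto simp: indicator_def)
  qed simp_all
  then have "(\<lambda>k. measure ?M (U (Suc k))) \<longlonglongrightarrow> measure ?M S"
    by (simp add: Int_absorb2 sets.sets_into_space[OF U_sets] sets.sets_into_space[OF S_sets])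
  then have "(\<lambda>k. real (card (Z (Suc k))) / real (Suc k) ^ card B) \<longlonglongrightarrow> measure ?M S"
    by (simp only: measure_U zero_less_Suc)
  then show ?thesis unfolding Z_def by (rule LIMSEQ_imp_Suc)
qed

section \<open>Polars, lattices and lattice frames\<close>

text \<open>
  The bipolar theorem for a finite system of inequalities. A point outside the hull of the normals
  is cut off by a hyperplane \<open>a \<bullet> x = c\<close>. Since \<open>0\<close> is in the hull, \<open>c < 0\<close>, so the projection of \<open>a\<close>
  to \<open>span Q\<close>, scaled by \<open>-1/c\<close>, is a point of \<open>Q\<close> that witnesses that the given point is not in the
  polar.
\<close>

lemma polar_eq_convex_hull_of_facet_normals:
  fixes F :: "'a::euclidean_space set"
  assumes "finite F" and F: "F \<subseteq> span Q"
    and Q: "Q = {y \<in> span Q. \<forall>f\<in>F. f \<bullet> y \<ge> -1}"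
    and zero: "0 \<in> convex hull F"
  shows "polar Q = convex hull F"
proof (rule equalityI[OF _ hull_minimal])
  show "F \<subseteq> polar Q" using F Q by (auto simp: polar_def)
  have "convex (\<Inter>v\<in>Q. {y. v \<bullet> y \<ge> -1})"
    by (intro convex_INT convex_halfspace_ge)
  then have "convex (span Q \<inter> (\<Inter>v\<in>Q. {y. v \<bullet> y \<ge> -1}))"
    by (intro convex_Int) (auto intro: subspace_imp_convex)
  moreover have "span Q \<inter> (\<Inter>v\<in>Q. {y. v \<bullet> y \<ge> -1}) = polar Q"
    by (auto simp: polar_def inner_commute)
  ultimately show "convex (polar Q)" by simp
  show "polar Q \<subseteq> convex hull F"
  proof (intro subsetI, rule ccontr)
    fix y assume y: "y \<in> polar Q" "y \<notin> convex hull F"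
    have "closed (convex hull F)"
      using \<open>finite F\<close> by (intro compact_imp_closed finite_imp_compact_convex_hull)
    with y obtain a c where ac: "a \<bullet> y < c" "\<forall>x\<in>convex hull F. c < a \<bullet> x"
      using separating_hyperplane_closed_point[of "convex hull F" y] by auto
    then have "c < 0" using zero by force
    \<comment> \<open>Only the component of \<open>a\<close> in \<open>span Q\<close> matters, because all vectors paired with it lie there.\<close>
    obtain u v where uv: "u \<in> span Q" "\<And>w. w \<in> span Q \<Longrightarrow> orthogonal v w" "a = u + v"
      using orthogonal_subspace_decomp_exists[of Q a] by metis
    have a_u: "a \<bullet> w = u \<bullet> w" if "w \<in> span Q" for w
      using uv(2)[OF that] by (simp add: uv(3) orthogonal_def inner_left_distrib)
    let ?w = "(1 / - c) *\<^sub>R u"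
    have "f \<bullet> ?w \<ge> -1" if "f \<in> F" for f
    proof -
      have "c < u \<bullet> f" using ac(2) a_u[of f] F that by (metis hull_inc subsetD)
      then show ?thesis using \<open>c < 0\<close> by (simp add: inner_commute field_simps)
    qed
    then have "?w \<in> Q" using uv(1) by (subst Q) (auto intro!: span_neg span_mul)
    then have "y \<bullet> ?w \<ge> -1" using y(1) unfolding polar_def by blast
    moreover have "u \<bullet> y < c" using ac(1) a_u[of y] y(1) by (simp add: polar_def)
    ultimately show False using \<open>c < 0\<close> by (simp add: inner_commute field_simps)
  qed
qed

lemma int_lattice_add: "x \<in> int_lattice \<Longrightarrow> y \<in> int_lattice \<Longrightarrow> x + y \<in> int_lattice"
  by (simp add: int_lattice_def inner_left_distrib)

lemma int_lattice_diff: "x \<in> int_lattice \<Longrightarrow> y \<in> int_lattice \<Longrightarrow> x - y \<in> int_lattice"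
  by (simp add: int_lattice_def inner_diff_left)

lemma int_lattice_scaleR: "x \<in> int_lattice \<Longrightarrow> c \<in> \<int> \<Longrightarrow> c *\<^sub>R x \<in> int_lattice"
  by (simp add: int_lattice_def)

lemma mem_int_lattice_matrix:
  "(x :: real ^ 'n::finite ^ 'n) \<in> int_lattice \<longleftrightarrow> (\<forall>i j. x $ i $ j \<in> \<int>)"
  by (auto simp: int_lattice_def Basis_vec_def inner_axis)

lemma affine_hull_int_lattice_points:
  assumes "V \<subseteq> int_lattice" "affine hull P = affine hull V"
  shows "affine hull (affine hull P \<inter> int_lattice) = affine hull P"
proof (rule equalityI)
  show "affine hull (affine hull P \<inter> int_lattice) \<subseteq> affine hull P"
    by (rule hull_minimal) auto
  have "V \<subseteq> affine hull P \<inter> int_lattice" using assms by (auto simp: hull_inc)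
  then show "affine hull P \<subseteq> affine hull (affine hull P \<inter> int_lattice)"
    unfolding assms(2) by (rule hull_mono)
qed

lemma lattice_frame_decompose:
  assumes "lattice_frame P p B" "x \<in> affine hull P" "x \<in> int_lattice"
  obtains c :: "'a::euclidean_space \<Rightarrow> int" where "x = p + (\<Sum>b\<in>B. of_int (c b) *\<^sub>R b)"
proof -
  have "x - p \<in> range (\<lambda>c. \<Sum>b\<in>B. of_int (c b) *\<^sub>R b)"
    using assms by (auto simp: lattice_frame_def lattice_basis_def)
  then obtain c where "x - p = (\<Sum>b\<in>B. of_int (c b) *\<^sub>R b)" by auto
  then show thesis using that[of c] by (simp add: algebra_simps)
qed

lemma lattice_frame_int_combination:
  assumes "lattice_frame P p B"
  shows "p + (\<Sum>b\<in>B. of_int (c b) *\<^sub>R b) \<in> affine hull P \<inter> int_lattice"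
proof -
  have "(\<Sum>b\<in>B. of_int (c b) *\<^sub>R b) \<in> (\<lambda>x. x - p) ` (affine hull P \<inter> int_lattice)"
    using assms by (auto simp: lattice_frame_def lattice_basis_def)
  then show ?thesis by auto
qed

lemma lattice_frame_independent: "lattice_frame P p B \<Longrightarrow> independent B"
  by (simp add: lattice_frame_def lattice_basis_def)

lemma lattice_frame_finite: "lattice_frame P p B \<Longrightarrow> finite B"
  by (rule independent_imp_finite) (rule lattice_frame_independent)

lemma lattice_frame_basis_vector:
  assumes "lattice_frame P p B" "b \<in> B"
  shows "p + b \<in> affine hull P \<inter> int_lattice"
proof -
  have "(\<Sum>x\<in>B. of_int (if x = b then 1 else 0) *\<^sub>R x) = (\<Sum>x\<in>B. if x = b then x else 0)"
    by (rule sum.cong) auto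
  also have "\<dots> = b"
    using assms by (simp add: lattice_frame_finite)
  finally show ?thesis
    using lattice_frame_int_combination[OF assms(1), of "\<lambda>x. if x = b then 1 else 0"] by simp
qed

lemma lattice_frame_combination:
  assumes "lattice_frame P p B"
  shows "p + (\<Sum>b\<in>B. c b *\<^sub>R b) \<in> affine hull P"
proof -
  have p: "p \<in> affine hull P" using assms by (simp add: lattice_frame_def)
  note hull = affine_hull_span_gen[OF p]
  have "b \<in> span ((\<lambda>x. - p + x) ` P)" if "b \<in> B" for b
    using lattice_frame_basis_vector[OF assms that] hull by auto
  then have "(\<Sum>b\<in>B. c b *\<^sub>R b) \<in> span ((\<lambda>x. - p + x) ` P)"
    by (intro span_sum span_mul)
  then show ?thesis using hull by auto
qed

lemma lattice_frame_coords_unique: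
  assumes "lattice_frame P p B" "(\<Sum>b\<in>B. c b *\<^sub>R b) = (\<Sum>b\<in>B. d b *\<^sub>R b)" "b \<in> B"
  shows "c b = d b"
proof -
  have "(\<Sum>b\<in>B. (c b - d b) *\<^sub>R b) = 0"
    using assms(2) by (simp add: scaleR_left_diff_distrib sum_subtractf)
  then show ?thesis
    using independentD[OF lattice_frame_independent[OF assms(1)] lattice_frame_finite[OF assms(1)] order_refl _ assms(3)]
    by fastforce
qed

text \<open>
  When the affine hull is generated by its lattice points, the basis of the translated lattice is
  also a linear basis of the direction space of the affine hull.
\<close>

lemma lattice_frame_card:
  assumes frame: "lattice_frame P p B" and hull: "affine hull (affine hull P \<inter> int_lattice) = affine hull P"
  shows "int (card B) = aff_dim P"
proof -
  let ?L = "affine hull P \<inter> int_lattice"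
  have p: "p \<in> affine hull P" using frame by (simp add: lattice_frame_def)
  have basis: "(\<lambda>x. x - p) ` ?L = range (\<lambda>c. \<Sum>b\<in>B. of_int (c b) *\<^sub>R b)"
    using frame by (simp add: lattice_frame_def lattice_basis_def)
  have "B \<subseteq> (\<lambda>x. x - p) ` ?L"
    using lattice_frame_basis_vector[OF frame] by force
  moreover have "(\<lambda>x. x - p) ` ?L \<subseteq> span B"
    unfolding basis by (auto intro!: span_sum intro: span_mul span_base)
  ultimately have span: "span ((\<lambda>x. x - p) ` ?L) = span B"
    by (meson span_minimal span_mono span_superset subspace_span subset_antisym subset_trans)
  have "affine hull P = (\<lambda>x. p + x) ` span ((\<lambda>x. - p + x) ` ?L)"
    using affine_hull_span_gen[of p ?L] p hull by simp
  then have "(\<lambda>x. x - p) ` (affine hull P) = span B"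
    using span by (simp add: image_image)
  moreover have "aff_dim P = dim ((\<lambda>x. x - p) ` (affine hull P))"
    using aff_dim_dim_affine_diffs[of "affine hull P" p] p by (simp add: aff_dim_affine_hull)
  ultimately show ?thesis
    by (simp add: dim_eq_card_independent lattice_frame_independent[OF frame])
qed

text \<open>
  Sending \<open>z\<close> to \<open>k p + \<Sum>b. z b b\<close> identifies the grid points \<open>z/k\<close> of the coordinate polytope with the
  lattice points of \<open>k P\<close>. For surjectivity, a lattice point \<open>x\<close> of \<open>k P\<close> is moved by \<open>(1 - k) p\<close>, which
  brings it into the affine hull of \<open>P\<close> itself, where the lattice basis applies.
\<close>

lemma ehrhart_eq_card_frame_points:
  assumes frame: "lattice_frame P p B" and "k > 0"
  shows "ehrhart P k = card {z \<in> B \<rightarrow>\<^sub>E (UNIV :: int set). (\<lambda>b\<in>B. of_int (z b) / real k) \<in> frame_coords p B P}"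
    (is "_ = card ?Z")
proof -
  define \<phi> where "\<phi> z = real k *\<^sub>R p + (\<Sum>b\<in>B. of_int (z b) *\<^sub>R b)" for z :: "'a \<Rightarrow> int"
  have p: "p \<in> affine hull P" "p \<in> int_lattice" using frame by (auto simp: lattice_frame_def)
  have scaled: "\<phi> z = real k *\<^sub>R (p + (\<Sum>b\<in>B. (\<lambda>b\<in>B. of_int (z b) / real k) b *\<^sub>R b))" for z
    using \<open>k > 0\<close> by (simp add: \<phi>_def scaleR_right_distrib scaleR_right.sum)
  have "bij_betw \<phi> ?Z (dilate k P \<inter> int_lattice)"
  proof (rule bij_betw_imageI)
    show "inj_on \<phi> ?Z"
    proof (rule inj_onI)
      fix z w assume zw: "z \<in> ?Z" "w \<in> ?Z" and eq: "\<phi> z = \<phi> w"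
      then have "(\<Sum>b\<in>B. real_of_int (z b) *\<^sub>R b) = (\<Sum>b\<in>B. real_of_int (w b) *\<^sub>R b)" by (simp add: \<phi>_def)
      then have "z b = w b" if "b \<in> B" for b
        using lattice_frame_coords_unique[OF frame _ that, of "\<lambda>b. real_of_int (z b)" "\<lambda>b. real_of_int (w b)"] by simp
      with zw show "z = w" by (auto intro: PiE_ext)
    qed
    show "\<phi> ` ?Z = dilate k P \<inter> int_lattice"
    proof (intro equalityI subsetI)
      fix x assume "x \<in> \<phi> ` ?Z"
      then obtain z where z: "z \<in> ?Z" "x = \<phi> z" by blast
      have "\<phi> z = (real k - 1) *\<^sub>R p + (p + (\<Sum>b\<in>B. of_int (z b) *\<^sub>R b))"
        by (simp add: \<phi>_def algebra_simps)
      then have "\<phi> z \<in> int_lattice"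
        using p lattice_frame_int_combination[OF frame, of z] by (auto intro!: int_lattice_add int_lattice_scaleR)
      moreover have "\<phi> z \<in> dilate k P"
        unfolding scaled using z by (auto simp: frame_coords_def dilate_def)
      ultimately show "x \<in> dilate k P \<inter> int_lattice" using z by simp
    next
      fix x assume x: "x \<in> dilate k P \<inter> int_lattice"
      then obtain y where y: "y \<in> P" "x = real k *\<^sub>R y" by (auto simp: dilate_def)
      have "(1 - real k) *\<^sub>R p + real k *\<^sub>R y \<in> affine hull P"
        using p y by (intro mem_affine) (auto simp: hull_inc)
      moreover have "(1 - real k) *\<^sub>R p + x \<in> int_lattice"
        using p x by (auto intro!: int_lattice_add int_lattice_scaleR)
      ultimately obtain c where c: "(1 - real k) *\<^sub>R p + x = p + (\<Sum>b\<in>B. of_int (c b) *\<^sub>R b)"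
        using lattice_frame_decompose[OF frame, of "(1 - real k) *\<^sub>R p + x"] y by metis
      then have "x = \<phi> c" by (simp add: \<phi>_def algebra_simps)
      also have "\<dots> = \<phi> (restrict c B)" by (simp add: \<phi>_def)
      finally have x_eq: "x = \<phi> (restrict c B)" .
      have "y = p + (\<Sum>b\<in>B. (\<lambda>b\<in>B. of_int (restrict c B b) / real k) b *\<^sub>R b)"
        using x_eq y(2) \<open>k > 0\<close> unfolding scaled by simp
      then have "restrict c B \<in> ?Z" using y(1) by (auto simp: frame_coords_def)
      then show "x \<in> \<phi> ` ?Z" using x_eq by blast
    qed
  qed
  then show ?thesis by (simp add: ehrhart_def bij_betw_same_card)
qed

text \<open>
  Each coordinate is the restriction of a linear functional on the ambient space, because the frame
  is linearly independent; hence it is bounded on a bounded set.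
\<close>

lemma frame_coords_bounded:
  assumes frame: "lattice_frame P p B" and "bounded P"
  obtains R where "frame_coords p B P \<subseteq> B \<rightarrow>\<^sub>E {-R..R}"
proof -
  obtain N where N: "\<And>x. x \<in> (\<lambda>x. x - p) ` P \<Longrightarrow> norm x \<le> N"
    using bounded_translation_minus[OF \<open>bounded P\<close>, of p] unfolding bounded_iff by blast
  have "\<exists>r. \<forall>c\<in>frame_coords p B P. \<bar>c b\<bar> \<le> r" if "b \<in> B" for b
  proof -
    obtain g :: "'a \<Rightarrow> real" where g: "linear g" "\<And>x. x \<in> B \<Longrightarrow> g x = (if x = b then 1 else 0)"
      using linear_independent_extend[OF lattice_frame_independent[OF frame], of "\<lambda>x. if x = b then 1 else (0::real)"] by auto
    obtain K where K: "K > 0" "\<And>x. norm (g x) \<le> norm x * K"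
      using bounded_linear.pos_bounded[OF linear_conv_bounded_linear[THEN iffD1, OF g(1)]] by blast
    have "\<bar>c b\<bar> \<le> N * K" if c: "c \<in> frame_coords p B P" for c
    proof -
      have "(\<Sum>x\<in>B. c x *\<^sub>R x) \<in> (\<lambda>x. x - p) ` P"
        using c by (force simp: frame_coords_def)
      then have "norm (\<Sum>x\<in>B. c x *\<^sub>R x) \<le> N" by (rule N)
      moreover have "g (\<Sum>x\<in>B. c x *\<^sub>R x) = (\<Sum>x\<in>B. if x = b then c x else 0)"
        unfolding linear_sum[OF g(1)] linear_cmul[OF g(1)] by (rule sum.cong) (auto simp: g)
      then have "g (\<Sum>x\<in>B. c x *\<^sub>R x) = c b"
        using \<open>b \<in> B\<close> lattice_frame_finite[OF frame] by simp
      ultimately show ?thesis using K(2)[of "\<Sum>x\<in>B. c x *\<^sub>R x"] K(1)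
        by (metis less_imp_le mult_right_mono order_trans real_norm_def)
    qed
    then show ?thesis by blast
  qed
  then obtain r where r: "\<And>b c. b \<in> B \<Longrightarrow> c \<in> frame_coords p B P \<Longrightarrow> \<bar>c b\<bar> \<le> r b" by metis
  have "c b \<in> {- (\<Sum>b\<in>B. \<bar>r b\<bar>)..(\<Sum>b\<in>B. \<bar>r b\<bar>)}" if "b \<in> B" "c \<in> frame_coords p B P" for b c
  proof -
    have "\<bar>c b\<bar> \<le> \<bar>r b\<bar>" using r[OF that] by simp
    also have "\<dots> \<le> (\<Sum>b\<in>B. \<bar>r b\<bar>)"
      using that lattice_frame_finite[OF frame] by (intro member_le_sum) auto
    finally show ?thesis by auto
  qed
  then have "frame_coords p B P \<subseteq> B \<rightarrow>\<^sub>E {- (\<Sum>b\<in>B. \<bar>r b\<bar>)..(\<Sum>b\<in>B. \<bar>r b\<bar>)}"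
    by (auto simp: frame_coords_def)
  then show thesis by (rule that)
qed

text \<open>
  The hypothesis on the functionals in \<open>F\<close> makes each of them depend on some coordinate of the frame.
  The limit is the same for every frame, which is how the volume is computed for a frame that is
  only known to exist.
\<close>

lemma ehrhart_over_power_tendsto_volume:
  assumes frame: "lattice_frame P p B" and "bounded P" and "finite F"
    and P: "P = {x \<in> affine hull P. \<forall>g\<in>F. 0 \<le> g \<bullet> x}"
    and nonconst: "\<And>g. g \<in> F \<Longrightarrow> \<exists>x\<in>affine hull P \<inter> int_lattice. \<exists>y\<in>affine hull P \<inter> int_lattice. g \<bullet> x \<noteq> g \<bullet> y"
  shows "(\<lambda>k. real (ehrhart P k) / real k ^ card B) \<longlonglongrightarrow> measure (PiM B (\<lambda>_. lborel)) (frame_coords p B P)"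
proof -
  obtain R where R: "frame_coords p B P \<subseteq> B \<rightarrow>\<^sub>E {-R..R}"
    using frame_coords_bounded[OF frame \<open>bounded P\<close>] .
  have "p + (\<Sum>b\<in>B. c b *\<^sub>R b) \<in> P \<longleftrightarrow> (\<forall>g\<in>F. 0 \<le> g \<bullet> p + (\<Sum>b\<in>B. (g \<bullet> b) * c b))" for c
    using lattice_frame_combination[OF frame]
    by (subst P) (simp add: inner_right_distrib inner_sum_right mult.commute)
  then have coords: "frame_coords p B P = {c \<in> B \<rightarrow>\<^sub>E UNIV. \<forall>g\<in>F. 0 \<le> g \<bullet> p + (\<Sum>b\<in>B. (g \<bullet> b) * c b)}"
    by (simp add: frame_coords_def)
  have "\<exists>b\<in>B. g \<bullet> b \<noteq> 0" if "g \<in> F" for g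
  proof (rule ccontr)
    assume "\<not> (\<exists>b\<in>B. g \<bullet> b \<noteq> 0)"
    then have "g \<bullet> x = g \<bullet> p" if "x \<in> affine hull P \<inter> int_lattice" for x
      using that by (auto elim!: lattice_frame_decompose[OF frame] simp: inner_right_distrib inner_sum_right)
    then show False using nonconst[OF that] by metis
  qed
  from lattice_count_tendsto_measure[OF lattice_frame_finite[OF frame] \<open>finite F\<close> this coords R]
  have "(\<lambda>k. real (card {z \<in> B \<rightarrow>\<^sub>E (UNIV :: int set). (\<lambda>b\<in>B. of_int (z b) / real k) \<in> frame_coords p B P}) / real k ^ card B)
    \<longlonglongrightarrow> measure (PiM B (\<lambda>_. lborel)) (frame_coords p B P)" .
  moreover have "\<forall>\<^sub>F k in sequentially. real (card {z \<in> B \<rightarrow>\<^sub>E (UNIV :: int set). (\<lambda>b\<in>B. of_int (z b) / real k) \<in> frame_coords p B P}) / real k ^ card B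
     = real (ehrhart P k) / real k ^ card B"
    using eventually_gt_at_top[of 0] by eventually_elim (simp add: ehrhart_eq_card_frame_points[OF frame])
  ultimately show ?thesis by (rule Lim_transform_eventually)
qed

lemma normalized_volume_eq_sum_h_star:
  assumes frame: "\<exists>p B. lattice_frame P p B"
    and hull: "affine hull (affine hull P \<inter> int_lattice) = affine hull P"
    and "bounded P" "finite F" "P = {x \<in> affine hull P. \<forall>g\<in>F. 0 \<le> g \<bullet> x}"
    and "\<And>g. g \<in> F \<Longrightarrow> \<exists>x\<in>affine hull P \<inter> int_lattice. \<exists>y\<in>affine hull P \<inter> int_lattice. g \<bullet> x \<noteq> g \<bullet> y"
    and gf: "Abs_fps (\<lambda>k. real (ehrhart P k)) = fps_of_poly h / (1 - fps_X) ^ (nat (aff_dim P) + 1)"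
  shows "normalized_volume P = poly h 1"
proof -
  \<comment> \<open>The definition of the volume picks an arbitrary frame, of which nothing else is known.\<close>
  obtain p B where SOME: "(SOME (p, B). lattice_frame P p B) = (p, B)" by force
  have pB: "lattice_frame P p B"
    using someI_ex[of "\<lambda>(p, B). lattice_frame P p B"] frame SOME by auto
  have d: "nat (aff_dim P) = card B" using lattice_frame_card[OF pB hull] by simp
  have "measure (PiM B (\<lambda>_. lborel)) (frame_coords p B P) = poly h 1 / fact (card B)"
  proof (rule LIMSEQ_unique)
    show "(\<lambda>k. real (ehrhart P k) / real k ^ card B) \<longlonglongrightarrow> measure (PiM B (\<lambda>_. lborel)) (frame_coords p B P)"
      by (rule ehrhart_over_power_tendsto_volume[OF pB assms(3-6)])
    show "(\<lambda>k. real (ehrhart P k) / real k ^ card B) \<longlonglongrightarrow> poly h 1 / fact (card B)"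
      by (rule series_coefficients_over_power_tendsto) (use gf d in simp)
  qed
  then show ?thesis
    unfolding normalized_volume_def SOME by (simp add: d)
qed

section \<open>Weighted sums of the dihedral permutation matrices\<close>

text \<open>
  The \<open>2n\<close> group elements are numbered by \<open>t < 2n\<close>: for \<open>t < n\<close> the rotation \<open>j \<mapsto> j + t\<close>, and for
  \<open>t \<ge> n\<close> the reflection \<open>j \<mapsto> t - j\<close>, modulo \<open>n\<close>. The entry \<open>(i, j)\<close> is nonzero in exactly one rotation
  matrix and one reflection matrix, and \<open>rot_pos i j\<close> and \<open>ref_pos i j\<close> are their numbers. So \<open>combo u\<close>
  below is the sum of all the matrices with weights \<open>u\<close>.
\<close>

locale dihedral_matrices =
  fixes n :: nat and idx :: "'n::finite \<Rightarrow> nat"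
  assumes n_ge: "n \<ge> 4" and n_even: "even n" and idx: "bij_betw idx UNIV {1..n}"
begin

definition rot_pos :: "'n \<Rightarrow> 'n \<Rightarrow> nat" where
  "rot_pos i j = nat ((int (idx i) - int (idx j)) mod int n)"

definition ref_pos :: "'n \<Rightarrow> 'n \<Rightarrow> nat" where
  "ref_pos i j = n + (idx i + idx j) mod n"

definition combo :: "(nat \<Rightarrow> real) \<Rightarrow> real ^ 'n ^ 'n" where
  "combo u = (\<chi> i j. u (rot_pos i j) + u (ref_pos i j))"

definition vertex :: "nat \<Rightarrow> real ^ 'n ^ 'n" where
  "vertex t = combo (\<lambda>s. if s = t then 1 else 0)"

lemma n_pos: "0 < n" "int n > 0" using n_ge by auto

lemma combo_nth [simp]: "combo u $ i $ j = u (rot_pos i j) + u (ref_pos i j)"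
  by (simp add: combo_def)

lemma rot_pos_less [simp]: "rot_pos i j < n"
  using n_pos pos_mod_bound[of "int n" "int (idx i) - int (idx j)"] pos_mod_sign[of "int n" "int (idx i) - int (idx j)"]
  unfolding rot_pos_def by linarith

lemma rot_pos_less_2n [simp]: "rot_pos i j < 2 * n"
  using rot_pos_less[of i j] by linarith

lemma ref_pos_bounds [simp]: "n \<le> ref_pos i j" "ref_pos i j < 2 * n"
  using n_pos by (auto simp: ref_pos_def mult_2)

lemma int_rot_pos: "int (rot_pos i j) = (int (idx i) - int (idx j)) mod int n"
  using n_pos by (simp add: rot_pos_def)

lemma int_ref_pos: "int (ref_pos i j) = int n + (int (idx i) + int (idx j)) mod int n"
  by (simp add: ref_pos_def zmod_int)

text \<open>
  This is where \<open>n\<close> must be even: the difference and the sum of two indices have the same parity, and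
  for even \<open>n\<close> the parity survives reduction modulo \<open>n\<close>.
\<close>

lemma even_pos: "even (rot_pos i j) \<longleftrightarrow> even (ref_pos i j)"
proof -
  have "even (x mod int n) \<longleftrightarrow> even x" for x
    using n_even by (simp add: dvd_mod_iff)
  then have "even (int (rot_pos i j)) \<longleftrightarrow> even (int (ref_pos i j))"
    using n_even by (simp add: int_rot_pos int_ref_pos)
  then show ?thesis by simp
qed

lemma idx_inj: "idx i = idx j \<longleftrightarrow> i = j"
  using idx by (auto simp: bij_betw_def dest: injD)

lemma idx_range: "idx i \<in> {1..n}"
  using idx by (auto simp: bij_betw_def)

lemma dvd_diff_imp_eq:
  assumes "a \<in> {1..n}" "b \<in> {1..n}" "int n dvd int a - int b"
  shows "a = b"
proof (rule ccontr)
  assume "a \<noteq> b"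
  then have "int n \<le> \<bar>int a - int b\<bar>" using assms(3) by (intro zdvd_imp_le[of "int n" "\<bar>_\<bar>"]) auto
  then show False using assms by auto
qed

lemma idx_cong_imp_eq:
  assumes "int (idx i) mod int n = int (idx j) mod int n"
  shows "i = j"
  using assms dvd_diff_imp_eq[OF idx_range[of i] idx_range[of j]] idx_inj by (simp add: mod_eq_dvd_iff)

lemma idx_surj_mod: "\<exists>i. int (idx i) mod int n = c mod int n"
proof -
  have "nat ((c - 1) mod int n) + 1 \<in> {1..n}"
    using n_pos by (simp add: Suc_le_eq nat_less_iff)
  then obtain i where "idx i = nat ((c - 1) mod int n) + 1"
    using idx unfolding bij_betw_def by (metis imageE)
  then have "int (idx i) = (c - 1) mod int n + 1"
    using n_pos by simp
  then have "int (idx i) mod int n = c mod int n"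
    by (simp add: mod_add_left_eq)
  then show ?thesis by blast
qed

text \<open>
  If \<open>k + l = 2 c\<close>, then \<open>i = c\<close> and \<open>j = c - k\<close> have difference \<open>k\<close> and sum \<open>l\<close>.
\<close>

lemma ex_entry:
  assumes "k < n" "n \<le> l" "l < 2 * n" "even k \<longleftrightarrow> even l"
  obtains i j where "rot_pos i j = k" "ref_pos i j = l"
proof -
  have "even (int k + int l)" using assms by simp
  then obtain c where c: "int k + int l = 2 * c" by (rule evenE)
  obtain i where i: "int (idx i) mod int n = c mod int n" using idx_surj_mod by blast
  obtain j where j: "int (idx j) mod int n = (c - int k) mod int n" using idx_surj_mod by blast
  have "(int (idx i) - int (idx j)) mod int n = (c - (c - int k)) mod int n"
    using i j by (rule mod_diff_cong)
  then have "int (rot_pos i j) = int k" using assms by (simp add: int_rot_pos)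
  moreover have "(int (idx i) + int (idx j)) mod int n = (c + (c - int k)) mod int n"
    using i j by (rule mod_add_cong)
  moreover have "c + (c - int k) = (int l - int n) + int n" using c by simp
  moreover have "((int l - int n) + int n) mod int n = int l - int n"
    unfolding mod_add_self2 by (rule mod_pos_pos_trivial) (use assms in auto)
  ultimately have "int (rot_pos i j) = int k" "int (ref_pos i j) = int l"
    by (simp_all add: int_ref_pos)
  then show thesis using that by simp
qed

text \<open>
  Along a row both numberings run once through all rotations and once through all reflections.
  Consequently the total weight depends only on the matrix and not on the weights that produce it.
\<close>

lemma row_sum: "(\<Sum>j\<in>UNIV. combo u $ i $ j) = (\<Sum>t<2*n. u t)"
proof -
  have card: "card (UNIV :: 'n set) = n"
    using bij_betw_same_card[OF idx] by simp
  have "bij_betw (rot_pos i) UNIV {..<n}"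
  proof (rule bij_betw_imageI)
    show inj: "inj (rot_pos i)"
    proof (rule injI)
      fix j j' assume "rot_pos i j = rot_pos i j'"
      then have "(int (idx i) - int (idx j)) mod int n = (int (idx i) - int (idx j')) mod int n"
        by (simp flip: int_rot_pos)
      then have "(int (idx i) - (int (idx i) - int (idx j))) mod int n = (int (idx i) - (int (idx i) - int (idx j'))) mod int n"
        by (rule mod_diff_cong[OF refl])
      then show "j = j'" by (intro idx_cong_imp_eq) simp
    qed
    show "range (rot_pos i) = {..<n}"
      by (rule card_subset_eq) (auto simp: card_image[OF inj] card)
  qed
  then have rot: "(\<Sum>j\<in>UNIV. u (rot_pos i j)) = (\<Sum>t<n. u t)"
    by (rule sum.reindex_bij_betw)
  have "bij_betw (ref_pos i) UNIV {n..<2*n}"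
  proof (rule bij_betw_imageI)
    show inj: "inj (ref_pos i)"
    proof (rule injI)
      fix j j' assume "ref_pos i j = ref_pos i j'"
      then have "int (ref_pos i j) = int (ref_pos i j')" by simp
      then have "(int (idx i) + int (idx j)) mod int n = (int (idx i) + int (idx j')) mod int n"
        by (simp only: int_ref_pos)
      then have "(int (idx i) + int (idx j) - int (idx i)) mod int n = (int (idx i) + int (idx j') - int (idx i)) mod int n"
        by (rule mod_diff_cong[OF _ refl])
      then show "j = j'" by (intro idx_cong_imp_eq) simp
    qed
    show "range (ref_pos i) = {n..<2*n}"
      by (rule card_subset_eq) (auto simp: card_image[OF inj] card)
  qed
  then have ref: "(\<Sum>j\<in>UNIV. u (ref_pos i j)) = (\<Sum>t\<in>{n..<2*n}. u t)"
    by (rule sum.reindex_bij_betw)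
  have split: "{..<2*n} = {..<n} \<union> {n..<2*n}" by auto
  have "(\<Sum>t<2*n. u t) = (\<Sum>t<n. u t) + (\<Sum>t\<in>{n..<2*n}. u t)"
    unfolding split by (rule sum.union_disjoint) auto
  then show ?thesis by (simp add: sum.distrib rot ref)
qed

lemma combo_cong: "(\<And>t. t < 2 * n \<Longrightarrow> u t = v t) \<Longrightarrow> combo u = combo v"
  by (simp add: vec_eq_iff)

lemma combo_add: "combo (\<lambda>t. u t + v t) = combo u + combo v"
  by (simp add: vec_eq_iff)

lemma combo_diff: "combo (\<lambda>t. u t - v t) = combo u - combo v"
  by (simp add: vec_eq_iff)

lemma combo_scale: "combo (\<lambda>t. c * u t) = c *\<^sub>R combo u"
  by (simp add: vec_eq_iff distrib_left)

lemma combo_zero: "combo (\<lambda>t. 0) = 0"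
  by (simp add: vec_eq_iff)

lemma combo_eq_sum: "combo u = (\<Sum>t<2*n. u t *\<^sub>R vertex t)"
proof -
  have "(\<Sum>t<2*n. u t *\<^sub>R vertex t) $ i $ j = combo u $ i $ j" for i j
  proof -
    have pick: "(\<Sum>t<2*n. u t * (if s = t then 1 else 0)) = u s" if "s < 2 * n" for s
      using that by (simp add: if_distrib[of "\<lambda>x. u _ * x"] cong: if_cong)
    have "(\<Sum>t<2*n. u t *\<^sub>R vertex t) $ i $ j = (\<Sum>t<2*n. u t * (if rot_pos i j = t then 1 else 0) + u t * (if ref_pos i j = t then 1 else 0))"
      by (simp add: vertex_def distrib_left)
    also have "\<dots> = u (rot_pos i j) + u (ref_pos i j)"
      by (simp only: sum.distrib pick rot_pos_less_2n ref_pos_bounds)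
    finally show ?thesis by simp
  qed
  then show ?thesis by (simp add: vec_eq_iff)
qed

lemma combo_eq_imp_sum_eq: "combo u = combo v \<Longrightarrow> (\<Sum>t<2*n. u t) = (\<Sum>t<2*n. v t)"
  using row_sum[of u] row_sum[of v] by metis

lemma combo_eq_iff:
  "combo u = combo v \<longleftrightarrow> (\<forall>k<n. \<forall>l\<in>{n..<2*n}. (even k \<longleftrightarrow> even l) \<longrightarrow> u k + u l = v k + v l)"
proof
  assume eq: "combo u = combo v"
  show "\<forall>k<n. \<forall>l\<in>{n..<2*n}. (even k \<longleftrightarrow> even l) \<longrightarrow> u k + u l = v k + v l"
  proof (intro allI ballI impI)
    fix k l assume "k < n" "l \<in> {n..<2*n}" "even k \<longleftrightarrow> even l"
    then obtain i j where "rot_pos i j = k" "ref_pos i j = l" using ex_entry by (metis atLeastLessThan_iff)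
    moreover have "combo u $ i $ j = combo v $ i $ j" using eq by simp
    ultimately show "u k + u l = v k + v l" by simp
  qed
next
  assume "\<forall>k<n. \<forall>l\<in>{n..<2*n}. (even k \<longleftrightarrow> even l) \<longrightarrow> u k + u l = v k + v l"
  then have "u (rot_pos i j) + u (ref_pos i j) = v (rot_pos i j) + v (ref_pos i j)" for i j
    using rot_pos_less[of i j] ref_pos_bounds[of i j] even_pos[of i j] by (metis atLeastLessThan_iff)
  then show "combo u = combo v" by (simp add: vec_eq_iff)
qed

text \<open>
  The linear relations among the matrices allow a constant to be moved from all rotations of one
  parity to all reflections of the same parity. This is the normal form in which the minimal weight
  of a rotation is zero within each parity class.
\<close>

definition reduced :: "(nat \<Rightarrow> real) \<Rightarrow> bool" where
  "reduced u \<longleftrightarrow> (\<forall>k<n. 0 \<le> u k) \<and> (\<exists>k<n. even k \<and> u k = 0) \<and> (\<exists>k<n. odd k \<and> u k = 0)"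

lemma reduced_representation:
  obtains v where "combo v = combo u" "reduced v"
proof -
  define E where "E b = {k. k < n \<and> even k = b}" for b
  define c where "c b = Min (u ` E b)" for b
  define v where "v t = (if t < n then u t - c (even t) else u t + c (even t))" for t
  have fin: "finite (u ` E b)" for b by (simp add: E_def)
  have "0 \<in> E True" "1 \<in> E False" using n_ge by (auto simp: E_def)
  then have "E b \<noteq> {}" for b by (cases "b = True") auto
  then have min: "c b \<in> u ` E b" "\<And>k. k \<in> E b \<Longrightarrow> c b \<le> u k" for b
    unfolding c_def using Min_in[OF fin] Min_le[OF fin] by simp_all
  have "\<exists>k<n. even k = b \<and> v k = 0" for b
  proof -
    obtain k where k: "k \<in> E b" "c b = u k" using min(1)[of b] by auto
    then have "k < n" "even k = b" by (simp_all add: E_def)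
    moreover from this k have "v k = 0" by (simp add: v_def)
    ultimately show ?thesis by (intro exI[of _ k] conjI)
  qed
  from this[of True] this[of False] have "\<exists>k<n. even k \<and> v k = 0" "\<exists>k<n. odd k \<and> v k = 0" by auto
  moreover have "v k \<ge> 0" if "k < n" for k
    using min(2)[of k "even k"] that by (simp add: v_def E_def)
  ultimately have "reduced v" by (simp add: reduced_def)
  moreover have "combo v = combo u"
    unfolding combo_eq_iff by (auto simp: v_def)
  ultimately show thesis using that by blast
qed

lemma reduced_unique:
  fixes u v :: "nat \<Rightarrow> real"
  assumes "reduced u" "reduced v" "combo u = combo v" "t < 2 * n"
  shows "u t = v t"
proof -
  have eq: "u k + u l = v k + v l" if "k < n" "n \<le> l" "l < 2*n" "even k = even l" for k l
    using assms(3) that unfolding combo_eq_iff by auto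
  have shift: "u k - v k = u k' - v k'" if "k < n" "k' < n" "even k = even k'" for k k'
    using eq[of k "n + k'"] eq[of k' "n + k'"] that n_even by auto
  obtain k k' where k: "k < n" "even k = even t" "u k = 0" and k': "k' < n" "even k' = even t" "v k' = 0"
    using assms(1,2) unfolding reduced_def by metis
  have "v k = 0"
  proof -
    have "0 \<le> v k" "0 \<le> u k'" using k k' assms(1,2) by (auto simp: reduced_def)
    then show ?thesis using shift[of k k'] k k' by auto
  qed
  show ?thesis
  proof (cases "t < n")
    case True
    then show ?thesis using shift[of t k] k \<open>v k = 0\<close> by auto
  next
    case False
    then show ?thesis using eq[of k t] k \<open>v k = 0\<close> assms(4) by auto
  qed
qed

text \<open>
  A reflection weight \<open>u t\<close> is itself an entry of the matrix: the entry that it shares with a rotation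
  of weight zero.
\<close>

lemma reduced_nonneg:
  assumes "reduced u" "\<And>i j. combo u $ i $ j \<ge> 0" "t < 2 * n"
  shows "u t \<ge> 0"
proof (cases "t < n")
  case False
  obtain k where k: "k < n" "even k = even t" "u k = 0"
    using assms(1) unfolding reduced_def by metis
  obtain i j where "rot_pos i j = k" "ref_pos i j = t"
    using ex_entry[of k t] k False assms(3) by auto
  then show ?thesis using assms(2)[of i j] k by simp
qed (use assms in \<open>simp add: reduced_def\<close>)

text \<open>
  Again every reflection weight is an entry of the matrix, and a rotation weight is the difference of
  an entry and a reflection weight.
\<close>

lemma reduced_integral:
  assumes "reduced u" "\<And>i j. combo u $ i $ j \<in> \<int>" "t < 2 * n"
  shows "u t \<in> \<int>"
proof -
  obtain k where k: "k < n" "even k = even t" "u k = 0"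
    using assms(1) unfolding reduced_def by metis
  have *: "u l \<in> \<int>" if l: "n \<le> l" "l < 2*n" "even l = even t" for l
  proof -
    obtain i j where "rot_pos i j = k" "ref_pos i j = l"
      using ex_entry[of k l] k l by auto
    then show ?thesis using assms(2)[of i j] k by simp
  qed
  show ?thesis
  proof (cases "t < n")
    case True
    then obtain i j where "rot_pos i j = t" "ref_pos i j = n + t"
      using ex_entry[of t "n + t"] n_even by auto
    then have "u t + u (n + t) \<in> \<int>" using assms(2)[of i j] by simp
    moreover have "u (n + t) \<in> \<int>" using * True n_even by auto
    ultimately show ?thesis using Ints_diff[of "u t + u (n + t)" "u (n + t)"] by simp
  qed (use * assms in auto)
qed

end

section \<open>The permutation matrices of the dihedral group\<close>

text \<open>
  The dihedral group in coordinates: \<open>j \<mapsto> \<epsilon> j + c\<close> modulo \<open>n\<close>, where \<open>\<epsilon> = 1\<close> for a rotation and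
  \<open>\<epsilon> = -1\<close> for a reflection. Divisibility is used because the representatives of the residue classes
  are \<open>1, \<dots>, n\<close> and not \<open>0, \<dots>, n - 1\<close>.
\<close>

definition acts_as_affine_map :: "nat \<Rightarrow> (nat \<Rightarrow> nat) \<Rightarrow> int \<Rightarrow> int \<Rightarrow> bool" where
  "acts_as_affine_map n \<sigma> \<epsilon> c \<longleftrightarrow>
     \<sigma> permutes {1..n} \<and> (\<forall>j\<in>{1..n}. int n dvd int (\<sigma> j) - (\<epsilon> * int j + c))"

lemma acts_as_affine_map_comp:
  assumes "acts_as_affine_map n \<sigma> \<epsilon> c" "acts_as_affine_map n \<tau> \<delta> d"
  shows "acts_as_affine_map n (\<sigma> \<circ> \<tau>) (\<epsilon> * \<delta>) (\<epsilon> * d + c)"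
  unfolding acts_as_affine_map_def
proof (intro conjI ballI)
  show "(\<sigma> \<circ> \<tau>) permutes {1..n}"
    using assms by (auto simp: acts_as_affine_map_def intro: permutes_compose)
  fix j assume j: "j \<in> {1..n}"
  then have "\<tau> j \<in> {1..n}"
    using assms(2) permutes_in_image[of \<tau> "{1..n}" j] by (auto simp: acts_as_affine_map_def)
  then have "int n dvd int (\<sigma> (\<tau> j)) - (\<epsilon> * int (\<tau> j) + c)" "int n dvd int (\<tau> j) - (\<delta> * int j + d)"
    using assms j by (auto simp: acts_as_affine_map_def)
  then have "int n dvd (int (\<sigma> (\<tau> j)) - (\<epsilon> * int (\<tau> j) + c)) + \<epsilon> * (int (\<tau> j) - (\<delta> * int j + d))"
    by (intro dvd_add dvd_mult)
  then show "int n dvd int ((\<sigma> \<circ> \<tau>) j) - (\<epsilon> * \<delta> * int j + (\<epsilon> * d + c))"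
    by (simp add: algebra_simps)
qed

lemma acts_as_affine_map_inv:
  assumes \<sigma>: "acts_as_affine_map n \<sigma> \<epsilon> c" and \<epsilon>: "\<epsilon> * \<epsilon> = 1"
  shows "acts_as_affine_map n (inv_into UNIV \<sigma>) \<epsilon> (- (\<epsilon> * c))"
  unfolding acts_as_affine_map_def
proof (intro conjI ballI)
  have perm: "\<sigma> permutes {1..n}" using \<sigma> by (simp add: acts_as_affine_map_def)
  show inv: "inv_into UNIV \<sigma> permutes {1..n}" using perm by (rule permutes_inv)
  fix j assume j: "j \<in> {1..n}"
  let ?i = "inv_into UNIV \<sigma> j"
  have "?i \<in> {1..n}" using permutes_in_image[OF inv] j by blast
  then have "int n dvd int (\<sigma> ?i) - (\<epsilon> * int ?i + c)" using \<sigma> by (simp add: acts_as_affine_map_def)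
  then have "int n dvd int j - (\<epsilon> * int ?i + c)" using permutes_inverses(1)[OF perm] by simp
  then have "int n dvd (- \<epsilon>) * (int j - (\<epsilon> * int ?i + c))" by (rule dvd_mult)
  also have "(- \<epsilon>) * (int j - (\<epsilon> * int ?i + c)) = (\<epsilon> * \<epsilon>) * int ?i - (\<epsilon> * int j + - (\<epsilon> * c))"
    by (simp add: algebra_simps)
  finally show "int n dvd int ?i - (\<epsilon> * int j + - (\<epsilon> * c))" using \<epsilon> by simp
qed

lemma dihedral_rotation_affine:
  assumes "n > 0"
  shows "acts_as_affine_map n (dihedral_rotation n) 1 1"
  unfolding acts_as_affine_map_def
proof (intro conjI ballI)
  have "inj_on (dihedral_rotation n) {1..n}"
    by (auto simp: inj_on_def dihedral_rotation_def split: if_splits)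
  moreover have "dihedral_rotation n ` {1..n} \<subseteq> {1..n}"
    by (auto simp: dihedral_rotation_def)
  ultimately have "bij_betw (dihedral_rotation n) {1..n} {1..n}"
    by (simp add: bij_betw_def endo_inj_surj)
  then show "dihedral_rotation n permutes {1..n}"
    by (rule bij_imp_permutes) (use assms in \<open>auto simp: dihedral_rotation_def\<close>)
qed (auto simp: dihedral_rotation_def)

lemma dihedral_reflection_affine: "acts_as_affine_map n (dihedral_reflection n) (-1) 2"
  unfolding acts_as_affine_map_def
proof (intro conjI ballI)
  have "inj_on (dihedral_reflection n) {1..n}"
    by (auto simp: inj_on_def dihedral_reflection_def split: if_splits)
  moreover have "dihedral_reflection n ` {1..n} \<subseteq> {1..n}"
    by (auto simp: dihedral_reflection_def)
  ultimately have "bij_betw (dihedral_reflection n) {1..n} {1..n}"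
    by (simp add: bij_betw_def endo_inj_surj)
  then show "dihedral_reflection n permutes {1..n}"
    by (rule bij_imp_permutes) (auto simp: dihedral_reflection_def)
  fix j assume "j \<in> {1..n}"
  then consider "j = 1" | "j \<in> {2..n}" by fastforce
  then show "int n dvd int (dihedral_reflection n j) - (- 1 * int j + 2)"
    by cases (auto simp: dihedral_reflection_def of_nat_diff)
qed

lemma dihedral_group_imp_affine:
  assumes "n > 0" "\<sigma> \<in> dihedral_group n"
  shows "\<exists>\<epsilon>\<in>{1, -1}. \<exists>c. acts_as_affine_map n \<sigma> \<epsilon> c"
  using assms(2) unfolding dihedral_group_def
proof (induction rule: generate.induct)
  case one
  have "acts_as_affine_map n id 1 0" by (simp add: acts_as_affine_map_def permutes_id)
  then show ?case unfolding sym_group_one by blast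
next
  case (incl \<sigma>)
  then show ?case using dihedral_rotation_affine[OF assms(1)] dihedral_reflection_affine by blast
next
  case (inv \<sigma>)
  then obtain \<epsilon> c where \<epsilon>: "\<epsilon> \<in> {1, -1}" "acts_as_affine_map n \<sigma> \<epsilon> c"
    using dihedral_rotation_affine[OF assms(1)] dihedral_reflection_affine by blast
  then have "acts_as_affine_map n (inv_into UNIV \<sigma>) \<epsilon> (- (\<epsilon> * c))"
    by (intro acts_as_affine_map_inv) auto
  moreover have "\<sigma> \<in> carrier (sym_group n)"
    using \<epsilon> by (simp add: sym_group_carrier acts_as_affine_map_def)
  ultimately show ?case using \<epsilon> by auto
next
  case (eng \<sigma> \<tau>)
  then obtain \<epsilon> c \<delta> d where "\<epsilon> \<in> {1, -1}" "acts_as_affine_map n \<sigma> \<epsilon> c" "\<delta> \<in> {1, -1}" "acts_as_affine_map n \<tau> \<delta> d"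
    by blast
  then have "\<epsilon> * \<delta> \<in> {1, -1}" "acts_as_affine_map n (\<sigma> \<circ> \<tau>) (\<epsilon> * \<delta>) (\<epsilon> * d + c)"
    using acts_as_affine_map_comp by auto
  then show ?case unfolding sym_group_mult by blast
qed

lemma dihedral_group_rotations:
  assumes "n > 0"
  shows "\<exists>\<sigma>\<in>dihedral_group n. acts_as_affine_map n \<sigma> 1 (int k)"
proof (induction k)
  case 0
  have "acts_as_affine_map n id 1 0" by (simp add: acts_as_affine_map_def permutes_id)
  moreover have "id \<in> dihedral_group n"
    unfolding dihedral_group_def using generate.one[of "sym_group n"] by (simp add: sym_group_one)
  ultimately show ?case by auto
next
  case (Suc k)
  then obtain \<sigma> where \<sigma>: "\<sigma> \<in> dihedral_group n" "acts_as_affine_map n \<sigma> 1 (int k)" by blast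
  have "\<sigma> \<circ> dihedral_rotation n \<in> dihedral_group n"
    using \<sigma>(1) generate.eng[of \<sigma> "sym_group n" "{dihedral_rotation n, dihedral_reflection n}" "dihedral_rotation n"]
    by (simp add: dihedral_group_def sym_group_mult generate.incl)
  moreover have "acts_as_affine_map n (\<sigma> \<circ> dihedral_rotation n) 1 (int (Suc k))"
    using acts_as_affine_map_comp[OF \<sigma>(2) dihedral_rotation_affine[OF assms]] by simp
  ultimately show ?case by blast
qed

lemma dihedral_group_reflections:
  assumes "n > 0"
  shows "\<exists>\<sigma>\<in>dihedral_group n. acts_as_affine_map n \<sigma> (-1) (int k + 2)"
proof -
  obtain \<sigma> where \<sigma>: "\<sigma> \<in> dihedral_group n" "acts_as_affine_map n \<sigma> 1 (int k)"
    using dihedral_group_rotations[OF assms] by blast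
  have "\<sigma> \<circ> dihedral_reflection n \<in> dihedral_group n"
    using \<sigma>(1) generate.eng[of \<sigma> "sym_group n" "{dihedral_rotation n, dihedral_reflection n}" "dihedral_reflection n"]
    by (simp add: dihedral_group_def sym_group_mult generate.incl)
  moreover have "acts_as_affine_map n (\<sigma> \<circ> dihedral_reflection n) (-1) (int k + 2)"
    using acts_as_affine_map_comp[OF \<sigma>(2) dihedral_reflection_affine] by (simp add: add.commute)
  ultimately show ?thesis by blast
qed

context dihedral_matrices begin

lemma perm_matrix_rotation:
  assumes "acts_as_affine_map n \<sigma> 1 c"
  shows "perm_matrix idx \<sigma> = vertex (nat (c mod int n))"
proof -
  have "idx i = \<sigma> (idx j) \<longleftrightarrow> rot_pos i j = nat (c mod int n)" for i j
  proof -
    have d: "int n dvd int (\<sigma> (idx j)) - (int (idx j) + c)"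
      using assms idx_range[of j] by (simp add: acts_as_affine_map_def)
    have "\<sigma> (idx j) \<in> {1..n}"
      using assms idx_range[of j] permutes_in_image[of \<sigma> "{1..n}" "idx j"] by (simp add: acts_as_affine_map_def)
    then have "idx i = \<sigma> (idx j) \<longleftrightarrow> int n dvd int (idx i) - int (\<sigma> (idx j))"
      using dvd_diff_imp_eq[of "idx i" "\<sigma> (idx j)"] idx_range[of i] by auto
    also have "\<dots> \<longleftrightarrow> int n dvd (int (idx i) - int (idx j)) - c"
      using dvd_add_left_iff[OF d, of "int (idx i) - int (\<sigma> (idx j))"] by (simp add: algebra_simps)
    also have "\<dots> \<longleftrightarrow> int (rot_pos i j) = c mod int n"
      unfolding int_rot_pos by (simp add: mod_eq_dvd_iff)
    also have "\<dots> \<longleftrightarrow> rot_pos i j = nat (c mod int n)" using n_pos by auto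
    finally show ?thesis .
  qed
  moreover have "ref_pos i j \<noteq> nat (c mod int n)" for i j
    using ref_pos_bounds(1)[of i j] pos_mod_bound[of "int n" c] n_pos by linarith
  ultimately show ?thesis by (simp add: vec_eq_iff perm_matrix_def vertex_def)
qed

lemma perm_matrix_reflection:
  assumes "acts_as_affine_map n \<sigma> (-1) c"
  shows "perm_matrix idx \<sigma> = vertex (n + nat (c mod int n))"
proof -
  have "idx i = \<sigma> (idx j) \<longleftrightarrow> ref_pos i j = n + nat (c mod int n)" for i j
  proof -
    have d: "int n dvd int (\<sigma> (idx j)) - (- int (idx j) + c)"
      using assms idx_range[of j] by (simp add: acts_as_affine_map_def)
    have "\<sigma> (idx j) \<in> {1..n}"
      using assms idx_range[of j] permutes_in_image[of \<sigma> "{1..n}" "idx j"] by (simp add: acts_as_affine_map_def)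
    then have "idx i = \<sigma> (idx j) \<longleftrightarrow> int n dvd int (idx i) - int (\<sigma> (idx j))"
      using dvd_diff_imp_eq[of "idx i" "\<sigma> (idx j)"] idx_range[of i] by auto
    also have "\<dots> \<longleftrightarrow> int n dvd (int (idx i) + int (idx j)) - c"
      using dvd_add_left_iff[OF d, of "int (idx i) - int (\<sigma> (idx j))"] by (simp add: algebra_simps)
    also have "\<dots> \<longleftrightarrow> int (ref_pos i j) = int n + c mod int n"
      unfolding int_ref_pos by (simp add: mod_eq_dvd_iff)
    also have "\<dots> \<longleftrightarrow> ref_pos i j = n + nat (c mod int n)"
      using n_pos pos_mod_sign[of "int n" c] by linarith
    finally show ?thesis .
  qed
  moreover have "rot_pos i j \<noteq> n + nat (c mod int n)" for i j
    using rot_pos_less[of i j] by linarith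
  ultimately show ?thesis by (simp add: vec_eq_iff perm_matrix_def vertex_def)
qed

lemma dihedral_perm_matrices: "perm_matrix idx ` dihedral_group n = vertex ` {..<2*n}"
proof (intro equalityI image_subsetI)
  fix \<sigma> assume "\<sigma> \<in> dihedral_group n"
  then obtain \<epsilon> c where "\<epsilon> = 1 \<or> \<epsilon> = -1" "acts_as_affine_map n \<sigma> \<epsilon> c"
    using dihedral_group_imp_affine[OF n_pos(1)] by blast
  moreover have "nat (c mod int n) < n" using n_pos by (simp add: nat_less_iff)
  ultimately show "perm_matrix idx \<sigma> \<in> vertex ` {..<2*n}"
    using perm_matrix_rotation[of \<sigma> c] perm_matrix_reflection[of \<sigma> c] by auto
next
  fix t assume t: "t \<in> {..<2*n}"
  show "vertex t \<in> perm_matrix idx ` dihedral_group n"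
  proof (cases "t < n")
    case True
    obtain \<sigma> where \<sigma>: "\<sigma> \<in> dihedral_group n" "acts_as_affine_map n \<sigma> 1 (int t)"
      using dihedral_group_rotations[OF n_pos(1)] by blast
    from perm_matrix_rotation[OF \<sigma>(2)] have "vertex t = perm_matrix idx \<sigma>" using True by simp
    with \<sigma>(1) show ?thesis by blast
  next
    case False
    \<comment> \<open>\<open>t - 2\<close> rotations after the reflection; \<open>t \<ge> n\<close> keeps the subtraction from truncating.\<close>
    obtain \<sigma> where \<sigma>: "\<sigma> \<in> dihedral_group n" "acts_as_affine_map n \<sigma> (-1) (int (t - 2) + 2)"
      using dihedral_group_reflections[OF n_pos(1)] by blast
    have "int (t - 2) + 2 = (int t - int n) + int n" using False n_ge by simp
    also have "\<dots> mod int n = int t - int n"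
      unfolding mod_add_self2 by (rule mod_pos_pos_trivial) (use False t in auto)
    finally have "perm_matrix idx \<sigma> = vertex (n + nat (int t - int n))"
      using perm_matrix_reflection[OF \<sigma>(2)] by simp
    moreover have "n + nat (int t - int n) = t" using False by simp
    ultimately have "vertex t = perm_matrix idx \<sigma>" by simp
    with \<sigma>(1) show ?thesis by blast
  qed
qed

lemma DP_eq_hull: "DP n idx = convex hull (vertex ` {..<2*n})"
  by (simp add: DP_def dihedral_perm_matrices)

end

section \<open>The Ehrhart series\<close>

lemma card_even_odd_below:
  assumes "even n"
  shows "card {t. t < n \<and> even t} = n div 2" "card {t. t < n \<and> odd t} = n div 2"
proof -
  obtain m where m: "n = 2 * m" using assms by (rule evenE)
  have "{t. t < n \<and> even t} = (\<lambda>i. 2 * i) ` {..<n div 2}"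
    using m by (auto elim!: evenE)
  then show "card {t. t < n \<and> even t} = n div 2" by (simp add: card_image inj_on_def)
  have "{t. t < n \<and> odd t} = (\<lambda>i. 2 * i + 1) ` {..<n div 2}"
    using m by (auto elim!: oddE)
  then show "card {t. t < n \<and> odd t} = n div 2" by (simp add: card_image inj_on_def)
qed

definition dihedral_h :: "nat \<Rightarrow> real poly" where
  "dihedral_h n = (\<Sum>i<n div 2. monom 1 i) ^ 2"

text \<open>
  Multiplying out, the coefficient counts the \<open>j\<close> with \<open>j < n/2\<close> and \<open>i - j < n/2\<close>. For \<open>i \<ge> n - 1\<close> the
  truncated subtraction gives the correct value zero.
\<close>

lemma coeff_dihedral_h:
  assumes "even n"
  shows "coeff (dihedral_h n) i = real (if i < n div 2 then i + 1 else n - 1 - i)"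
proof -
  let ?m = "n div 2"
  have c: "coeff (\<Sum>i<?m. monom 1 i :: real poly) j = (if j < ?m then 1 else 0)" for j
    by (simp add: coeff_sum)
  have "coeff (dihedral_h n) i = (\<Sum>j\<le>i. (if j < ?m then 1 else 0) * (if i - j < ?m then 1 else 0))"
    unfolding dihedral_h_def power2_eq_square coeff_mult c ..
  also have "\<dots> = (\<Sum>j\<le>i. if j < ?m \<and> i - j < ?m then 1 else 0)"
    by (rule sum.cong) auto
  also have "\<dots> = real (card {j\<in>{..i}. j < ?m \<and> i - j < ?m})"
    by (simp flip: sum.inter_filter)
  also have "{j\<in>{..i}. j < ?m \<and> i - j < ?m} = {i + 1 - ?m..<min (i + 1) ?m}"
    by auto
  also have "card \<dots> = (if i < ?m then i + 1 else n - 1 - i)"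
    using assms(1) by (auto elim!: evenE)
  finally show ?thesis .
qed

lemma coeffs_dihedral_h:
  assumes "even n" "n \<ge> 4"
  shows "coeffs (dihedral_h n) = map real ([1..<n div 2] @ rev [1..<n div 2 + 1])"
proof -
  have deg: "degree (dihedral_h n) = n - 2"
  proof (rule antisym)
    show "degree (dihedral_h n) \<le> n - 2" by (rule degree_le) (use assms(2) in \<open>auto simp: coeff_dihedral_h[OF assms(1)]\<close>)
    show "n - 2 \<le> degree (dihedral_h n)" by (rule le_degree) (use assms(2) in \<open>auto simp: coeff_dihedral_h[OF assms(1)]\<close>)
  qed
  then have "dihedral_h n \<noteq> 0" using assms(2) by auto
  obtain m where m: "n = 2 * m" "m \<ge> 2" using assms by (auto elim!: evenE)
  have coeff: "coeff (dihedral_h (2 * m)) i = real (if i < m then i + 1 else 2 * m - 1 - i)" for i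
    using coeff_dihedral_h[OF assms(1), of i] m by simp
  have "coeffs (dihedral_h n) = map (coeff (dihedral_h n)) [0..<n - 1]"
    using deg \<open>dihedral_h n \<noteq> 0\<close> assms(2) by (simp add: coeffs_def Suc_diff_le numeral_2_eq_2 Suc_diff_Suc)
  also have "\<dots> = map real ([1..<n div 2] @ rev [1..<n div 2 + 1])"
    by (rule nth_equalityI) (use m in \<open>auto simp: coeff nth_append rev_nth simp del: upt_Suc\<close>)
  finally show ?thesis .
qed

lemma poly_dihedral_h_1:
  assumes "even n"
  shows "poly (dihedral_h n) 1 = (real n)\<^sup>2 / 4"
  using assms(1) by (auto simp: dihedral_h_def poly_sum poly_monom power2_eq_square elim!: evenE)

context dihedral_matrices begin

abbreviation P :: "(real ^ 'n ^ 'n) set" where "P \<equiv> DP n idx"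

lemma vertex_int: "vertex t \<in> int_lattice"
  by (simp add: mem_int_lattice_matrix vertex_def)

lemma vertex_in_P: "t < 2 * n \<Longrightarrow> vertex t \<in> P"
  by (auto simp: DP_eq_hull hull_inc)

text \<open>
  Membership in the hull asks for nonnegative weights, but nonnegative entries suffice: pass to
  reduced weights.
\<close>

lemma P_eq: "P = {combo u |u. (\<Sum>t<2*n. u t) = 1 \<and> (\<forall>i j. 0 \<le> combo u $ i $ j)}" (is "_ = ?R")
proof (rule equalityI)
  show "P \<subseteq> ?R"
    unfolding DP_eq_hull
  proof (rule hull_minimal)
    show "vertex ` {..<2*n} \<subseteq> ?R"
    proof (rule image_subsetI)
      fix t assume "t \<in> {..<2*n}"
      then show "vertex t \<in> ?R"
        unfolding vertex_def by (intro CollectI exI[of _ "\<lambda>s. if s = t then 1 else 0"]) simp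
    qed
    show "convex ?R"
    proof (rule convexI)
      fix x y and a b :: real assume ab: "0 \<le> a" "0 \<le> b" "a + b = 1" and "x \<in> ?R" "y \<in> ?R"
      then obtain u v where u: "x = combo u" "(\<Sum>t<2*n. u t) = 1" "\<forall>i j. 0 \<le> combo u $ i $ j"
        and v: "y = combo v" "(\<Sum>t<2*n. v t) = 1" "\<forall>i j. 0 \<le> combo v $ i $ j" by blast
      let ?w = "\<lambda>t. a * u t + b * v t"
      have w: "a *\<^sub>R x + b *\<^sub>R y = combo ?w" by (simp add: u v combo_add combo_scale)
      moreover have "(\<Sum>t<2*n. ?w t) = 1" using u v ab by (simp add: sum.distrib flip: sum_distrib_left)
      moreover have "\<forall>i j. 0 \<le> combo ?w $ i $ j"
        unfolding w[symmetric] using u v ab by simp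
      ultimately show "a *\<^sub>R x + b *\<^sub>R y \<in> ?R" by blast
    qed
  qed
  \<comment> \<open>The reduced weights of \<open>x\<close> are the coefficients of a convex combination of the vertices.\<close>
  show "?R \<subseteq> P"
  proof
    fix x assume "x \<in> ?R"
    then obtain u where u: "x = combo u" "(\<Sum>t<2*n. u t) = 1" "\<forall>i j. 0 \<le> combo u $ i $ j" by blast
    obtain v where v: "combo v = combo u" "reduced v"
      by (rule reduced_representation[of u])
    have "v t \<ge> 0" if "t < 2 * n" for t
      using reduced_nonneg[OF v(2) _ that] u v by simp
    moreover have "(\<Sum>t<2*n. v t) = 1" using combo_eq_imp_sum_eq[OF v(1)] u by simp
    ultimately have "(\<Sum>t<2*n. v t *\<^sub>R vertex t) \<in> P"
      unfolding DP_eq_hull by (intro convex_sum) (auto simp: hull_inc)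
    then show "x \<in> P" using u v combo_eq_sum[of v] by simp
  qed
qed

lemma sum_vertex_diff: "(\<Sum>t<2*n. u t *\<^sub>R (vertex t - vertex 0)) = combo u - (\<Sum>t<2*n. u t) *\<^sub>R vertex 0"
  by (simp add: combo_eq_sum[of u] scaleR_right_diff_distrib sum_subtractf scaleR_left.sum)

lemma affine_hull_P: "affine hull P = {combo u |u. (\<Sum>t<2*n. u t) = 1}" (is "_ = ?R")
proof (rule equalityI)
  show "affine hull P \<subseteq> ?R"
  proof (rule hull_minimal)
    show "P \<subseteq> ?R" unfolding P_eq by blast
    show "affine ?R"
      unfolding affine_def
    proof (intro ballI allI impI)
      fix x y and a b :: real assume ab: "a + b = 1" and "x \<in> ?R" "y \<in> ?R"
      then obtain u v where u: "x = combo u" "(\<Sum>t<2*n. u t) = 1" and v: "y = combo v" "(\<Sum>t<2*n. v t) = 1" by blast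
      let ?w = "\<lambda>t. a * u t + b * v t"
      have "a *\<^sub>R x + b *\<^sub>R y = combo ?w" by (simp add: u v combo_add combo_scale)
      moreover have "(\<Sum>t<2*n. ?w t) = 1" using u v ab by (simp add: sum.distrib flip: sum_distrib_left)
      ultimately show "a *\<^sub>R x + b *\<^sub>R y \<in> ?R" by blast
    qed
  qed
  show "?R \<subseteq> affine hull P"
  proof
    fix x assume "x \<in> ?R"
    then obtain u where u: "x = combo u" "(\<Sum>t<2*n. u t) = 1" by blast
    have v0: "vertex 0 \<in> affine hull P" using vertex_in_P n_pos by (simp add: hull_inc)
    have "(\<Sum>t<2*n. u t *\<^sub>R (vertex t - vertex 0)) \<in> span ((\<lambda>x. - vertex 0 + x) ` P)"
      using vertex_in_P by (intro span_sum span_mul span_base) (auto simp: image_iff intro!: bexI[of _ "vertex _"])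
    moreover have "x = vertex 0 + (\<Sum>t<2*n. u t *\<^sub>R (vertex t - vertex 0))" using u sum_vertex_diff[of u] by simp
    ultimately show "x \<in> affine hull P" unfolding affine_hull_span_gen[OF v0] by blast
  qed
qed

lemma dilate_P: "dilate k P = {combo u |u. (\<Sum>t<2*n. u t) = real k \<and> (\<forall>i j. 0 \<le> combo u $ i $ j)}" (is "_ = ?R")
proof (intro equalityI subsetI)
  fix x assume "x \<in> dilate k P"
  then obtain u where u: "x = real k *\<^sub>R combo u" "(\<Sum>t<2*n. u t) = 1" "\<forall>i j. 0 \<le> combo u $ i $ j"
    unfolding dilate_def P_eq by blast
  then have x: "x = combo (\<lambda>t. real k * u t)" by (simp add: combo_scale)
  moreover have "(\<Sum>t<2*n. real k * u t) = real k" using u by (simp flip: sum_distrib_left)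
  moreover have "\<forall>i j. 0 \<le> combo (\<lambda>t. real k * u t) $ i $ j" unfolding x[symmetric] u(1) using u(3) by simp
  ultimately show "x \<in> ?R" by blast
next
  fix x assume "x \<in> ?R"
  then obtain u where u: "x = combo u" "(\<Sum>t<2*n. u t) = real k" "\<forall>i j. 0 \<le> combo u $ i $ j" by blast
  show "x \<in> dilate k P"
  \<comment> \<open>Dilating by zero gives the single point \<open>0\<close>, so here the weights must be shown to vanish.\<close>
  proof (cases "k = 0")
    case True
    obtain v where v: "combo v = combo u" "reduced v"
      by (rule reduced_representation[of u])
    have "v t \<ge> 0" if "t < 2 * n" for t
      using reduced_nonneg[OF v(2) _ that] u v by simp
    moreover have "(\<Sum>t<2*n. v t) = 0" using combo_eq_imp_sum_eq[OF v(1)] u True by simp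
    ultimately have "v t = 0" if "t < 2 * n" for t
      using that sum_nonneg_eq_0_iff[of "{..<2*n}" v] by auto
    then have "combo v = 0" using combo_cong[of v "\<lambda>_. 0"] combo_zero by simp
    then show ?thesis using u v True vertex_in_P[of 0] n_pos by (auto simp: dilate_def)
  next
    case False
    let ?v = "\<lambda>t. (1 / real k) * u t"
    have v: "combo ?v = (1 / real k) *\<^sub>R x" unfolding u(1) by (rule combo_scale)
    moreover have "(\<Sum>t<2*n. ?v t) = 1" unfolding sum_distrib_left[symmetric] u(2) using False by simp
    moreover have "\<forall>i j. 0 \<le> combo ?v $ i $ j" unfolding v using u by simp
    ultimately have "combo ?v \<in> P" unfolding P_eq by blast
    then have "(1 / real k) *\<^sub>R x \<in> P" unfolding v .
    then show ?thesis using False by (auto simp: dilate_def image_iff intro!: bexI[of _ "(1 / real k) *\<^sub>R x"])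
  qed
qed

text \<open>
  The lattice points of \<open>k P\<close> correspond to their reduced weights, and these are exactly the weak
  compositions of \<open>k\<close> with a zero at some even and at some odd rotation.
\<close>

lemma ehrhart_P: "ehrhart P k =
    card {f \<in> weak_comps (2*n) k. (\<exists>t\<in>{t. t < n \<and> even t}. f t = 0) \<and> (\<exists>t\<in>{t. t < n \<and> odd t}. f t = 0)}"
    (is "_ = card ?N")
proof -
  define g where "g f = combo (\<lambda>t. real (f t))" for f :: "nat \<Rightarrow> nat"
  have reduced: "reduced (\<lambda>t. real (f t))" if "f \<in> ?N" for f
    using that by (auto simp: reduced_def)
  have "bij_betw g ?N (dilate k P \<inter> int_lattice)"
  proof (rule bij_betw_imageI)
    show "inj_on g ?N"
    proof (rule inj_onI)
      fix f f' assume f: "f \<in> ?N" "f' \<in> ?N" "g f = g f'"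
      have "f t = f' t" for t
      proof (cases "t < 2 * n")
        case True
        have "real (f t) = real (f' t)"
          by (rule reduced_unique[OF reduced[OF f(1)] reduced[OF f(2)]]) (use f(3) True in \<open>auto simp: g_def\<close>)
        then show ?thesis by simp
      next
        case False
        then show ?thesis using f by (auto simp: weak_comps_def)
      qed
      then show "f = f'" by blast
    qed
    show "g ` ?N = dilate k P \<inter> int_lattice"
    proof (intro equalityI subsetI)
      fix x assume "x \<in> g ` ?N"
      then obtain f where f: "x = g f" "f \<in> weak_comps (2*n) k" by blast
      have "(\<Sum>t<2*n. real (f t)) = real k"
        using f(2) by (simp add: weak_comps_def flip: of_nat_sum)
      then have "x \<in> dilate k P" unfolding dilate_P f(1) g_def by fastforce
      then show "x \<in> dilate k P \<inter> int_lattice" by (simp add: f(1) g_def mem_int_lattice_matrix)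
    next
      fix x assume x: "x \<in> dilate k P \<inter> int_lattice"
      then obtain u where u: "x = combo u" "(\<Sum>t<2*n. u t) = real k" "\<forall>i j. 0 \<le> combo u $ i $ j"
        unfolding dilate_P by blast
      obtain v where v: "combo v = combo u" "reduced v"
        by (rule reduced_representation[of u])
      have nonneg: "v t \<ge> 0" if "t < 2 * n" for t
        using reduced_nonneg[OF v(2) _ that] u v by simp
      have int: "v t \<in> \<int>" if "t < 2 * n" for t
        using reduced_integral[OF v(2) _ that] x u(1) v(1) by (simp only: mem_int_lattice_matrix Int_iff)
      define f where "f t = (if t < 2 * n then nat \<lfloor>v t\<rfloor> else 0)" for t
      have fv: "real (f t) = v t" if "t < 2 * n" for t
        using nonneg[OF that] int[OF that] that by (auto simp: f_def elim!: Ints_cases)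
      have "(\<Sum>t<2*n. real (f t)) = (\<Sum>t<2*n. v t)" by (rule sum.cong) (auto simp: fv)
      also have "\<dots> = real k" using combo_eq_imp_sum_eq[OF v(1)] u by simp
      finally have "(\<Sum>t<2*n. f t) = k" by (simp flip: of_nat_sum)
      then have "f \<in> weak_comps (2*n) k" by (simp add: weak_comps_def f_def)
      moreover obtain a b where "a < n" "even a" "v a = 0" "b < n" "odd b" "v b = 0"
        using v(2) unfolding reduced_def by blast
      then have "a \<in> {t. t < n \<and> even t}" "f a = 0" "b \<in> {t. t < n \<and> odd t}" "f b = 0" by (simp_all add: f_def)
      ultimately have "f \<in> ?N" by blast
      moreover have "x = g f" unfolding u(1) v(1)[symmetric] g_def by (rule combo_cong) (simp add: fv)
      ultimately show "x \<in> g ` ?N" by blast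
    qed
  qed
  then show ?thesis by (simp add: ehrhart_def bij_betw_same_card)
qed

text \<open>
  From the count of the reduced weights the series is \<open>(1 - X^(n/2))^2 / (1 - X)^(2n)\<close>, in which two
  factors \<open>1 - X\<close> cancel.
\<close>

lemma ehrhart_series_P:
  "Abs_fps (\<lambda>k. real (ehrhart P k)) = fps_of_poly (dihedral_h n) / (1 - fps_X) ^ (2 * n - 2)"
proof -
  have "Abs_fps (\<lambda>k. real (ehrhart P k)) = (1 - fps_X ^ (n div 2)) * (1 - fps_X ^ (n div 2)) * geometric_fps ^ (2 * n)"
  proof (rule fps_ext)
    fix k
    have "{t. t < n \<and> even t} \<subseteq> {..<2*n}" "{t. t < n \<and> odd t} \<subseteq> {..<2*n}" "{t. t < n \<and> even t} \<inter> {t. t < n \<and> odd t} = {}" by auto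
    from card_weak_comps_zero_in_each[OF _ this, of k]
    show "fps_nth (Abs_fps (\<lambda>k. real (ehrhart P k))) k =
      fps_nth ((1 - fps_X ^ (n div 2)) * (1 - fps_X ^ (n div 2)) * geometric_fps ^ (2 * n)) k"
      using n_pos by (simp add: ehrhart_P card_even_odd_below[OF n_even])
  qed
  also have "2 * n = 2 + (2 * n - 2)" using n_ge by simp
  also have "geometric_fps ^ (2 + (2 * n - 2)) = geometric_fps ^ 2 * geometric_fps ^ (2 * n - 2)"
    by (rule power_add)
  also have "1 - fps_X ^ (n div 2) = (1 - fps_X) * (\<Sum>i<n div 2. fps_X ^ i :: real fps)"
    by (rule one_diff_power_eq)
  also have "(1 - fps_X) * (\<Sum>i<n div 2. fps_X ^ i) * ((1 - fps_X) * (\<Sum>i<n div 2. fps_X ^ i)) *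
        (geometric_fps ^ 2 * geometric_fps ^ (2 * n - 2))
      = ((1 - fps_X) * geometric_fps) ^ 2 * (\<Sum>i<n div 2. fps_X ^ i) ^ 2 * geometric_fps ^ (2 * n - 2)"
    by (simp add: power2_eq_square mult_ac)
  also have "\<dots> = fps_of_poly (dihedral_h n) * geometric_fps ^ (2 * n - 2)"
    by (simp add: one_minus_X_geometric dihedral_h_def fps_of_poly_power fps_of_poly_sum fps_of_poly_monom')
  finally show ?thesis by (simp add: divide_one_minus_X_power)
qed

section \<open>A lattice frame, the dimension and the volume\<close>

text \<open>
  The even and the odd relation between rotations and reflections can be used to remove one
  reflection of each parity, namely the numbers \<open>n\<close> and \<open>n + 1\<close>. The other \<open>2n - 2\<close> vertices are
  affinely independent; number \<open>0\<close> serves as the origin of the frame.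
\<close>

definition free_vertices :: "nat set" where "free_vertices = {1..<2*n} - {n, n + 1}"

definition frame :: "(real ^ 'n ^ 'n) set" where "frame = (\<lambda>t. vertex t - vertex 0) ` free_vertices"

lemma finite_free_vertices [simp]: "finite free_vertices" by (simp add: free_vertices_def)

lemma card_free_vertices: "card free_vertices = 2 * n - 3"
  unfolding free_vertices_def using n_ge by (subst card_Diff_subset) auto

lemma free_vertices_less: "t \<in> free_vertices \<Longrightarrow> t < 2 * n"
  by (simp add: free_vertices_def)

lemma sum_split_free_vertices:
  fixes x :: "nat \<Rightarrow> 'v::real_vector"
  assumes "u n = 0" "u (n + 1) = 0"
  shows "(\<Sum>t<2*n. u t *\<^sub>R x t) = u 0 *\<^sub>R x 0 + (\<Sum>t\<in>free_vertices. u t *\<^sub>R x t)"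
proof -
  have "{..<2*n} = insert 0 (insert n (insert (n + 1) free_vertices))"
    using n_ge by (auto simp: free_vertices_def)
  moreover have "0 \<notin> free_vertices" "n \<notin> free_vertices" "n + 1 \<notin> free_vertices" by (auto simp: free_vertices_def)
  ultimately show ?thesis using assms n_ge by simp
qed

lemma combo_eq_frame:
  assumes "u n = 0" "u (n + 1) = 0"
  shows "combo u = (\<Sum>t<2*n. u t) *\<^sub>R vertex 0 + (\<Sum>t\<in>free_vertices. u t *\<^sub>R (vertex t - vertex 0))"
  using sum_vertex_diff[of u] sum_split_free_vertices[OF assms, of "\<lambda>t. vertex t - vertex 0"] by (simp add: algebra_simps)

text \<open>
  Extend the coefficients to weights with sum zero, with weight zero at the two removed reflections.
  If the weighted sum vanishes, every rotation weight is zero by comparison with the removed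
  reflection of its parity, and then so is every reflection weight.
\<close>

lemma frame_coefficients_zero:
  assumes "(\<Sum>t\<in>free_vertices. c t *\<^sub>R (vertex t - vertex 0)) = 0" "t \<in> free_vertices"
  shows "c t = 0"
proof -
  define u where "u t = (if t \<in> free_vertices then c t else if t = 0 then - sum c free_vertices else 0)" for t
  have notin: "0 \<notin> free_vertices" "n \<notin> free_vertices" "n + 1 \<notin> free_vertices" by (auto simp: free_vertices_def)
  have un: "u n = 0" "u (n + 1) = 0" using notin n_ge by (auto simp: u_def)
  have "(\<Sum>t<2*n. u t) = 0"
    using sum_split_free_vertices[OF un, of "\<lambda>_. 1::real"] notin by (simp add: u_def)
  moreover have "(\<Sum>t\<in>free_vertices. u t *\<^sub>R (vertex t - vertex 0)) = (\<Sum>t\<in>free_vertices. c t *\<^sub>R (vertex t - vertex 0))"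
    by (rule sum.cong) (auto simp: u_def)
  ultimately have "combo u = 0" using combo_eq_frame[OF un] assms(1) by simp
  then have "combo u = combo (\<lambda>_. 0)" by (simp add: combo_zero)
  then have eq: "u k + u l = 0" if "k < n" "n \<le> l" "l < 2*n" "even k = even l" for k l
    using that unfolding combo_eq_iff by simp
  have rot: "u k = 0" if "k < n" for k
    using eq[of k n] eq[of k "n + 1"] that un n_even n_ge by (cases "even k") auto
  have "u l = 0" if "n \<le> l" "l < 2 * n" for l
    using eq[of 0 l] eq[of 1 l] rot[of 0] rot[of 1] that n_ge by (cases "even l") auto
  then have "u t = 0" using rot[of t] free_vertices_less[OF assms(2)] by (cases "t < n") auto
  then show ?thesis using assms(2) by (simp add: u_def)
qed

lemma inj_frame: "inj_on (\<lambda>t. vertex t - vertex 0) free_vertices"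
proof (rule inj_onI, rule ccontr)
  fix s t assume st: "s \<in> free_vertices" "t \<in> free_vertices" "vertex s - vertex 0 = vertex t - vertex 0" "s \<noteq> t"
  let ?c = "\<lambda>r. (if r = s then 1 else 0) - (if r = t then 1 else 0) :: real"
  have "(\<Sum>r\<in>free_vertices. ?c r *\<^sub>R (vertex r - vertex 0)) = (\<Sum>r\<in>free_vertices. (if r = s then vertex r - vertex 0 else 0) - (if r = t then vertex r - vertex 0 else 0))"
    by (rule sum.cong) (auto simp: scaleR_left_diff_distrib)
  also have "\<dots> = 0" using st by (simp add: sum_subtractf)
  finally have "?c s = 0" using st(1) by (rule frame_coefficients_zero)
  then show False using st(4) by simp
qed

lemma sum_frame: "(\<Sum>b\<in>frame. c b *\<^sub>R b) = (\<Sum>t\<in>free_vertices. c (vertex t - vertex 0) *\<^sub>R (vertex t - vertex 0))"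
  unfolding frame_def by (simp add: sum.reindex[OF inj_frame])

lemma independent_frame: "independent frame"
proof (rule independent_if_scalars_zero)
  show "finite frame" by (simp add: frame_def)
  fix f :: "real ^ 'n ^ 'n \<Rightarrow> real" and x
  assume "(\<Sum>x\<in>frame. f x *\<^sub>R x) = 0" "x \<in> frame"
  then show "f x = 0"
    using frame_coefficients_zero[of "\<lambda>t. f (vertex t - vertex 0)"] unfolding sum_frame by (auto simp: frame_def)
qed

text \<open>
  Given integer entries, move constants between rotations and reflections until the weights of the
  two removed reflections are zero. Then each rotation weight is a matrix entry, hence an integer, and
  so is each reflection weight.
\<close>

lemma lattice_frame_P: "lattice_frame P (vertex 0) frame"
  unfolding lattice_frame_def lattice_basis_def
proof (intro conjI independent_frame)
  let ?L = "affine hull P \<inter> int_lattice"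
  show "vertex 0 \<in> ?L" using vertex_in_P[of 0] n_pos by (simp add: hull_inc vertex_int)
  show "(\<lambda>x. x - vertex 0) ` ?L = range (\<lambda>c. \<Sum>b\<in>frame. of_int (c b) *\<^sub>R b)"
  proof (intro equalityI subsetI)
    fix y assume "y \<in> (\<lambda>x. x - vertex 0) ` ?L"
    then obtain u where u: "y = combo u - vertex 0" "(\<Sum>t<2*n. u t) = 1" "combo u \<in> int_lattice"
      unfolding affine_hull_P by blast
    define d where "d b = (if b then u n else u (n + 1))" for b
    define v where "v t = (if t < n then u t + d (even t) else u t - d (even t))" for t
    have combo_v: "combo v = combo u" unfolding combo_eq_iff by (auto simp: v_def)
    have vn: "v n = 0" "v (n + 1) = 0" using n_even by (simp_all add: v_def d_def)
    have entry: "combo v $ i $ j \<in> \<int>" for i j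
      using u(3) unfolding combo_v mem_int_lattice_matrix by blast
    have sum: "v k + v l \<in> \<int>" if kl: "k < n" "n \<le> l" "l < 2 * n" "even k = even l" for k l
    proof -
      obtain i j where "rot_pos i j = k" "ref_pos i j = l" using ex_entry[of k l] kl by auto
      then show ?thesis using entry[of i j] by simp
    qed
    have rot: "v k \<in> \<int>" if "k < n" for k
      using sum[of k n] sum[of k "n + 1"] vn that n_even n_ge by (cases "even k") auto
    have ref: "v l \<in> \<int>" if l: "n \<le> l" "l < 2 * n" for l
    proof -
      obtain k where k: "k < n" "even k = even l"
        using n_ge by (metis One_nat_def even_zero less_le_trans odd_one zero_less_numeral one_less_numeral_iff semiring_norm(76))
      then show ?thesis using Ints_diff[OF sum[OF k(1) l k(2)] rot[OF k(1)]] by simp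
    qed
    have int: "of_int \<lfloor>v t\<rfloor> = v t" if "t < 2 * n" for t
      using rot[of t] ref[of t] that by (cases "t < n") (auto elim!: Ints_cases)
    define c where "c b = \<lfloor>v (inv_into free_vertices (\<lambda>t. vertex t - vertex 0) b)\<rfloor>" for b
    have "(\<Sum>b\<in>frame. of_int (c b) *\<^sub>R b) = (\<Sum>t\<in>free_vertices. v t *\<^sub>R (vertex t - vertex 0))"
      unfolding sum_frame by (rule sum.cong) (auto simp: c_def inv_into_f_f[OF inj_frame] int free_vertices_less)
    also have "\<dots> = combo v - vertex 0"
      using combo_eq_frame[OF vn] combo_eq_imp_sum_eq[OF combo_v] u(2) by simp
    also have "\<dots> = y" by (simp add: combo_v u)
    finally show "y \<in> range (\<lambda>c. \<Sum>b\<in>frame. of_int (c b) *\<^sub>R b)" by blast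
  next
    fix y assume "y \<in> range (\<lambda>c. \<Sum>b\<in>frame. real_of_int (c b) *\<^sub>R b)"
    then obtain c where c: "y = (\<Sum>b\<in>frame. real_of_int (c b) *\<^sub>R b)" by blast
    have "y \<in> span ((\<lambda>x. - vertex 0 + x) ` P)"
      unfolding c frame_def using vertex_in_P free_vertices_less
      by (intro span_sum span_mul span_base) (auto simp: image_iff intro!: bexI[of _ "vertex _"])
    moreover have v0: "vertex 0 \<in> affine hull P" using vertex_in_P n_pos by (simp add: hull_inc)
    ultimately have "vertex 0 + y \<in> affine hull P" unfolding affine_hull_span_gen[OF v0] by blast
    moreover have "(vertex 0 + y) \<in> int_lattice"
    proof -
      have "vertex t $ i $ j \<in> \<int>" for t i j using vertex_int mem_int_lattice_matrix by blast
      then show ?thesis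
        unfolding c sum_frame mem_int_lattice_matrix by (auto intro!: Ints_add Ints_sum Ints_mult Ints_diff)
    qed
    ultimately have "vertex 0 + y \<in> ?L" by blast
    then show "y \<in> (\<lambda>x. x - vertex 0) ` ?L" by (rule rev_image_eqI) simp
  qed
qed

lemma affine_hull_lattice_P: "affine hull (affine hull P \<inter> int_lattice) = affine hull P"
  by (rule affine_hull_int_lattice_points[of "vertex ` {..<2*n}"]) (auto simp: vertex_int DP_eq_hull)

lemma aff_dim_P: "aff_dim P = 2 * int n - 3"
proof -
  have "aff_dim P = int (card frame)"
    using lattice_frame_card[OF lattice_frame_P affine_hull_lattice_P] by simp
  also have "card frame = 2 * n - 3" by (simp add: frame_def card_image[OF inj_frame] card_free_vertices)
  finally show ?thesis using n_ge by simp
qed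

lemma ehrhart_series_P_aff_dim:
  "Abs_fps (\<lambda>k. real (ehrhart P k)) = fps_of_poly (dihedral_h n) / (1 - fps_X) ^ (nat (aff_dim P) + 1)"
proof -
  have "nat (aff_dim P) + 1 = 2 * n - 2" using n_ge by (simp add: aff_dim_P)
  then show ?thesis by (simp add: ehrhart_series_P)
qed

text \<open>
  Multiplication by a power of \<open>1 - X\<close> is injective, so the Ehrhart series determines the numerator.
\<close>

lemma h_star_poly_P: "h_star_poly P = dihedral_h n"
  unfolding h_star_poly_def
proof (rule the_equality)
  show "Abs_fps (\<lambda>k. real (ehrhart P k)) = fps_of_poly (dihedral_h n) / (1 - fps_X) ^ (nat (aff_dim P) + 1)"
    by (rule ehrhart_series_P_aff_dim)
  fix g assume "Abs_fps (\<lambda>k. real (ehrhart P k)) = fps_of_poly g / (1 - fps_X) ^ (nat (aff_dim P) + 1)"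
  then have "fps_of_poly g / (1 - fps_X) ^ (nat (aff_dim P) + 1) = fps_of_poly (dihedral_h n) / (1 - fps_X) ^ (nat (aff_dim P) + 1)"
    using ehrhart_series_P_aff_dim by simp
  moreover have "(geometric_fps ^ (nat (aff_dim P) + 1) :: real fps) \<noteq> 0"
    using one_minus_X_geometric by (intro power_not_zero) (metis mult_zero_right zero_neq_one)
  ultimately show "g = dihedral_h n"
    unfolding divide_one_minus_X_power by (simp add: fps_of_poly_eq_iff del: power_Suc)
qed

definition entry_functionals :: "(real ^ 'n ^ 'n) set" where
  "entry_functionals = {axis i (axis j 1) |i j. True}"

lemma inner_entry [simp]: "axis i (axis j 1) \<bullet> (x :: real ^ 'n ^ 'n) = x $ i $ j"
  by (simp add: inner_axis')

lemma entry_functionals_range: "entry_functionals = (\<lambda>(i, j). axis i (axis j 1)) ` UNIV"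
  by (auto simp: entry_functionals_def)

lemma normalized_volume_P: "normalized_volume P = (real n)\<^sup>2 / 4"
proof -
  have "normalized_volume P = poly (dihedral_h n) 1"
  proof (rule normalized_volume_eq_sum_h_star[where F = entry_functionals])
    show "\<exists>p B. lattice_frame P p B" using lattice_frame_P by blast
    show "affine hull (affine hull P \<inter> int_lattice) = affine hull P" by (rule affine_hull_lattice_P)
    show "bounded P" unfolding DP_eq_hull by (intro compact_imp_bounded finite_imp_compact_convex_hull) simp
    show "finite entry_functionals" by (simp add: entry_functionals_range)
    show "P = {x \<in> affine hull P. \<forall>g\<in>entry_functionals. 0 \<le> g \<bullet> x}"
    proof -
      have "(\<forall>g\<in>entry_functionals. 0 \<le> g \<bullet> x) \<longleftrightarrow> (\<forall>i j. 0 \<le> x $ i $ j)" for x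
        by (auto simp: entry_functionals_range)
      then show ?thesis unfolding affine_hull_P by (subst P_eq) blast
    qed
    show "Abs_fps (\<lambda>k. real (ehrhart P k)) = fps_of_poly (dihedral_h n) / (1 - fps_X) ^ (nat (aff_dim P) + 1)"
      by (rule ehrhart_series_P_aff_dim)
    fix g assume "g \<in> entry_functionals"
    then obtain i j where g: "g = axis i (axis j 1)" by (auto simp: entry_functionals_def)
    \<comment> \<open>The entry \<open>(i, j)\<close> is \<open>1\<close> in the rotation \<open>rot_pos i j\<close> and \<open>0\<close> in any other rotation, for instance
      \<open>s\<close>.\<close>
    define s where "s = (if rot_pos i j = 0 then 1 else 0 :: nat)"
    have "1 < ref_pos i j" using n_ge ref_pos_bounds(1)[of i j] by linarith
    then have s: "s < n" "s \<noteq> rot_pos i j" "s \<noteq> ref_pos i j"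
      using n_ge by (auto simp: s_def)
    have "vertex t \<in> affine hull P \<inter> int_lattice" if "t < n" for t
      using vertex_in_P[of t] that by (simp add: hull_inc vertex_int)
    moreover have "g \<bullet> vertex (rot_pos i j) \<noteq> g \<bullet> vertex s"
      using s unfolding g inner_entry by (simp add: vertex_def)
    ultimately show "\<exists>x\<in>affine hull P \<inter> int_lattice. \<exists>y\<in>affine hull P \<inter> int_lattice. g \<bullet> x \<noteq> g \<bullet> y"
      using s rot_pos_less by blast
  qed
  then show ?thesis by (simp add: poly_dihedral_h_1[OF n_even])
qed

section \<open>The Gorenstein property\<close>

definition all_ones :: "real ^ 'n ^ 'n" where "all_ones = (\<chi> i j. 1)"

definition direction :: "(real ^ 'n ^ 'n) set" where "direction = {combo u |u. (\<Sum>t<2*n. u t) = 0}"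

text \<open>
  The all-ones matrix is the sum of the \<open>n\<close> rotation matrices, so it is a lattice point of \<open>n P\<close>. It has
  lattice distance one from each of the bounding inequalities \<open>x\<^sub>i\<^sub>j \<ge> 0\<close>.
\<close>

definition centered :: "(real ^ 'n ^ 'n) set" where "centered = (\<lambda>x. x - all_ones) ` dilate n P"

lemma all_ones_eq: "all_ones = combo (\<lambda>t. if t < n then 1 else 0)"
  by (simp add: all_ones_def vec_eq_iff not_less)

lemma all_ones_sum: "(\<Sum>t<2*n. if t < n then 1 else 0 :: real) = real n"
proof -
  have "{..<2*n} \<inter> {t. t < n} = {..<n}" by auto
  then show ?thesis by (simp add: sum.If_cases)
qed

lemma subspace_direction: "subspace direction"
proof (rule subspaceI)
  show "0 \<in> direction" unfolding direction_def using combo_zero by fastforce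
next
  fix x y assume "x \<in> direction" "y \<in> direction"
  then obtain u v where "x = combo u" "(\<Sum>t<2*n. u t) = 0" "y = combo v" "(\<Sum>t<2*n. v t) = 0" by (auto simp: direction_def)
  then have "x + y = combo (\<lambda>t. u t + v t)" "(\<Sum>t<2*n. u t + v t) = 0" by (simp_all add: combo_add sum.distrib)
  then show "x + y \<in> direction" unfolding direction_def by blast
next
  fix x c assume "x \<in> direction"
  then obtain u where "x = combo u" "(\<Sum>t<2*n. u t) = 0" by (auto simp: direction_def)
  then have "c *\<^sub>R x = combo (\<lambda>t. c * u t)" "(\<Sum>t<2*n. c * u t) = 0" by (simp_all add: combo_scale flip: sum_distrib_left)
  then show "c *\<^sub>R x \<in> direction" unfolding direction_def by blast
qed

text \<open>
  Subtracting the all-ones matrix turns the inequalities \<open>x\<^sub>i\<^sub>j \<ge> 0\<close> that define \<open>n P\<close> into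
  \<open>y\<^sub>i\<^sub>j \<ge> -1\<close>.
\<close>

lemma centered_eq: "centered = {y \<in> direction. \<forall>i j. -1 \<le> y $ i $ j}"
proof (intro equalityI subsetI)
  fix y assume "y \<in> centered"
  then obtain u where u: "y = combo u - all_ones" "(\<Sum>t<2*n. u t) = real n" "\<forall>i j. 0 \<le> combo u $ i $ j"
    unfolding centered_def dilate_P by blast
  have "y = combo (\<lambda>t. u t - (if t < n then 1 else 0))" unfolding combo_diff u(1) all_ones_eq ..
  moreover have "(\<Sum>t<2*n. u t - (if t < n then 1 else 0)) = 0" by (simp only: sum_subtractf u all_ones_sum)
  ultimately have "y \<in> direction" unfolding direction_def by blast
  moreover have "-1 \<le> y $ i $ j" for i j using u by (simp add: all_ones_def del: combo_nth)
  ultimately show "y \<in> {y \<in> direction. \<forall>i j. -1 \<le> y $ i $ j}" by blast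
next
  fix y assume "y \<in> {y \<in> direction. \<forall>i j. -1 \<le> y $ i $ j}"
  then obtain u where u: "y = combo u" "(\<Sum>t<2*n. u t) = 0" "\<forall>i j. -1 \<le> y $ i $ j" by (auto simp: direction_def)
  let ?v = "\<lambda>t. u t + (if t < n then 1 else 0)"
  have v: "combo ?v = y + all_ones" unfolding combo_add u(1) all_ones_eq ..
  moreover have "(\<Sum>t<2*n. ?v t) = real n" by (simp only: sum.distrib u all_ones_sum)
  moreover have "0 \<le> combo ?v $ i $ j" for i j
  proof -
    have "-1 \<le> y $ i $ j" using u(3) by blast
    then show ?thesis unfolding v by (simp add: all_ones_def)
  qed
  ultimately have "combo ?v \<in> dilate n P" unfolding dilate_P by blast
  then have "y + all_ones \<in> dilate n P" unfolding v .
  then show "y \<in> centered" unfolding centered_def by force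
qed

lemma entry_le_norm: "\<bar>x $ i $ j\<bar> \<le> norm (x :: real ^ 'n ^ 'n)"
  using component_le_norm_cart[of "x $ i" j] Finite_Cartesian_Product.norm_nth_le[of x i] by linarith

lemma ball_direction_subset_centered: "ball 0 1 \<inter> direction \<subseteq> centered"
proof
  fix y assume y: "y \<in> ball 0 1 \<inter> direction"
  then have "norm y < 1" by simp
  then have "-1 \<le> y $ i $ j" for i j using entry_le_norm[of y i j] by linarith
  then show "y \<in> centered" using y by (simp add: centered_eq)
qed

lemma span_centered: "span centered = direction"
proof (rule equalityI)
  show "span centered \<subseteq> direction" by (rule span_minimal) (auto simp: centered_eq subspace_direction)
  show "direction \<subseteq> span centered"
  proof
    fix y assume y: "y \<in> direction"
    define e where "e = 1 / (norm y + 1)"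
    have e: "e > 0" "norm (e *\<^sub>R y) < 1"
      using norm_ge_zero[of y] by (auto simp: e_def field_simps add_pos_nonneg add_nonneg_pos)
    then have "e *\<^sub>R y \<in> span centered"
      using ball_direction_subset_centered y subspace_direction by (intro span_base) (auto simp: subspace_scale)
    then have "(1 / e) *\<^sub>R (e *\<^sub>R y) \<in> span centered" by (rule span_mul)
    then show "y \<in> span centered" using e by simp
  qed
qed

lemma zero_in_rel_interior_centered: "0 \<in> rel_interior centered"
proof -
  have "affine hull centered \<subseteq> direction"
    by (rule hull_minimal) (auto simp: centered_eq subspace_direction subspace_imp_affine)
  then have "ball 0 1 \<inter> affine hull centered \<subseteq> centered" using ball_direction_subset_centered by blast
  moreover have "0 \<in> centered" using ball_direction_subset_centered subspace_0[OF subspace_direction] by auto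
  ultimately show ?thesis unfolding mem_rel_interior_ball by (metis zero_less_one)
qed

lemma all_ones_int: "all_ones \<in> int_lattice"
  by (simp add: mem_int_lattice_matrix all_ones_def)

lemma all_ones_in_rel_interior: "all_ones \<in> rel_interior (dilate n P)"
proof -
  have "dilate n P = (\<lambda>x. all_ones + x) ` centered" by (simp add: centered_def image_image)
  then have "rel_interior (dilate n P) = (\<lambda>x. all_ones + x) ` rel_interior centered"
    by (simp add: rel_interior_translation)
  then show ?thesis using zero_in_rel_interior_centered by force
qed

lemma lattice_polytope_centered: "lattice_polytope (int_lattice \<inter> span centered) centered"
  unfolding lattice_polytope_def
proof
  define vert where "vert = (\<lambda>x. - all_ones + real n *\<^sub>R x) ` vertex ` {..<2*n}"
  have hull: "centered = convex hull vert"
    unfolding vert_def convex_hull_affinity DP_eq_hull[symmetric] by (simp add: centered_def dilate_def image_image)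
  show "polytope centered" unfolding polytope_def using hull by (intro exI[of _ vert]) (simp add: vert_def)
  have "- all_ones + real n *\<^sub>R vertex t \<in> int_lattice" for t
    using int_lattice_diff[OF int_lattice_scaleR[OF vertex_int[of t], of "real n"] all_ones_int] by simp
  then have "vert \<subseteq> int_lattice" unfolding vert_def by blast
  moreover have "vert \<subseteq> span centered" using hull_subset[of vert convex] span_superset[of centered] unfolding hull by (rule order_trans)
  moreover have "{v. v extreme_point_of centered} \<subseteq> vert" unfolding hull by (rule extreme_points_of_convex_hull)
  ultimately show "{v. v extreme_point_of centered} \<subseteq> int_lattice \<inter> span centered" by (meson Int_greatest order_trans)
qed

lemma lattice_polytope_P: "lattice_polytope int_lattice P"
  unfolding lattice_polytope_def
proof
  show "polytope P" unfolding polytope_def DP_eq_hull by (intro exI[of _ "vertex ` {..<2*n}"]) simp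
  have "{v. v extreme_point_of P} \<subseteq> vertex ` {..<2*n}"
    unfolding DP_eq_hull by (rule extreme_points_of_convex_hull)
  also have "\<dots> \<subseteq> int_lattice" using vertex_int by blast
  finally show "{v. v extreme_point_of P} \<subseteq> int_lattice" .
qed

text \<open>
  On the direction space the functional \<open>y \<mapsto> y\<^sub>i\<^sub>j\<close> is represented by the orthogonal projection of a
  matrix unit. It takes integer values on lattice points, so it lies in the dual lattice although its
  own entries need not be integers.
\<close>

lemma ex_facet_normal: "\<exists>e\<in>direction. \<forall>y\<in>direction. e \<bullet> y = y $ i $ j"
proof -
  have span: "span direction = direction" using subspace_direction by simp
  obtain e z where e: "e \<in> span direction" "\<And>w. w \<in> span direction \<Longrightarrow> orthogonal z w" "axis i (axis j 1) = e + z"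
    using orthogonal_subspace_decomp_exists[of direction "axis i (axis j 1)"] by metis
  have "e \<bullet> y = y $ i $ j" if "y \<in> direction" for y
  proof -
    have "y $ i $ j = (e + z) \<bullet> y" unfolding e(3)[symmetric] by simp
    also have "\<dots> = e \<bullet> y" using e(2)[of y] that span by (simp add: inner_left_distrib orthogonal_def)
    finally show ?thesis by simp
  qed
  then show ?thesis using e(1) span by blast
qed

text \<open>
  The polar is the convex hull of the normals from the preceding lemma, so its vertices are in
  the dual lattice. The point \<open>0\<close> is in this hull: the sum of all normals represents the functional
  that sums all entries, and this functional vanishes on the direction space.
\<close>

lemma reflexive_centered: "reflexive centered"
  unfolding reflexive_def
proof (intro conjI lattice_polytope_centered zero_in_rel_interior_centered)
  obtain e where e: "\<And>i j. e i j \<in> direction" "\<And>i j y. y \<in> direction \<Longrightarrow> e i j \<bullet> y = y $ i $ j"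
    using ex_facet_normal by metis
  define F where "F = range (\<lambda>(i, j). e i j)"
  have F: "finite F" "F \<subseteq> span centered" by (auto simp: F_def e span_centered)
  have "polar centered = convex hull F"
  proof (rule polar_eq_convex_hull_of_facet_normals[OF F])
    show "centered = {y \<in> span centered. \<forall>f\<in>F. -1 \<le> f \<bullet> y}"
      unfolding span_centered by (subst centered_eq) (auto simp: F_def e)
    define s where "s = (\<Sum>p\<in>UNIV. case p of (i, j) \<Rightarrow> e i j)"
    have "s \<in> direction" unfolding s_def by (intro subspace_sum subspace_direction) (auto simp: e)
    moreover have "s \<bullet> y = 0" if "y \<in> direction" for y
    proof -
      obtain u where u: "y = combo u" "(\<Sum>t<2*n. u t) = 0" using \<open>y \<in> direction\<close> unfolding direction_def by blast
      have "s \<bullet> y = (\<Sum>p\<in>UNIV. case p of (i, j) \<Rightarrow> y $ i $ j)"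
        unfolding s_def inner_sum_left by (rule sum.cong) (auto simp: e that)
      also have "\<dots> = (\<Sum>i\<in>UNIV. \<Sum>j\<in>UNIV. y $ i $ j)"
        by (simp add: sum.cartesian_product)
      also have "\<dots> = 0" unfolding u(1) row_sum u(2) by simp
      finally show ?thesis .
    qed
    ultimately have "s = 0" using inner_eq_zero_iff by blast
    let ?N = "real CARD('n \<times> 'n)"
    have "(\<Sum>p\<in>UNIV. (1 / ?N) *\<^sub>R (case p of (i, j) \<Rightarrow> e i j)) \<in> convex hull F"
      by (rule convex_sum) (auto simp: F_def intro!: hull_inc)
    then show "0 \<in> convex hull F" using \<open>s = 0\<close> unfolding s_def by (simp flip: scaleR_right.sum)
  qed
  moreover have "F \<subseteq> dual_lattice (span centered) (int_lattice \<inter> span centered)"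
    by (auto simp: F_def dual_lattice_def span_centered e mem_int_lattice_matrix)
  ultimately show "lattice_polytope (dual_lattice (span centered) (int_lattice \<inter> span centered)) (polar centered)"
    using F(1) extreme_points_of_convex_hull[of F] unfolding lattice_polytope_def polytope_def by auto
qed

lemma gorenstein_P: "gorenstein_of_codegree P n"
  unfolding gorenstein_of_codegree_def
  using lattice_polytope_P n_pos all_ones_in_rel_interior all_ones_int reflexive_centered unfolding centered_def by blast

end

section \<open>The dihedral permutation polytope for even \<open>n\<close>\<close>

theorem corollary5p4:
  fixes n :: nat and idx :: "'n::finite \<Rightarrow> nat"
  assumes "n \<ge> 4" and "even n"
    and "bij_betw idx UNIV {1..n}"
  shows "h_star_vector (DP n idx) = map real ([1..<n div 2] @ rev [1..<n div 2 + 1])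
    \<and> gorenstein_of_codegree (DP n idx) n
    \<and> normalized_volume (DP n idx) = (real n)\<^sup>2 / 4"
proof -
  interpret dihedral_matrices n idx by standard (use assms in auto)
  show ?thesis
    unfolding h_star_vector_def h_star_poly_P coeffs_dihedral_h[OF assms(2,1)]
    using gorenstein_P normalized_volume_P by simp
qed

end
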